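(* For any $1/3 \le \alpha \le 1$, Max $\alpha$-FCGP admits an FPT approximation scheme running in time $\left(\frac{1}{\varepsilon}\right)^{\mathcal{O}(k)} \cdot n^{\mathcal{O}(1)}$: given a graph $G=(V,E)$ on $n$ vertices, an integer $k$ and $0<\varepsilon<1$, it finds in this time a set $S \subseteq V$ of size $k$ with $\mathrm{cov}_\alpha(S) \ge (1-\varepsilon)\cdot \mathrm{OPT}$, where $\mathrm{OPT}$ is the maximum of $\mathrm{cov}_\alpha(S')$ over all $k$-vertex sets $S' \subseteq V$.
   Context: Graphs are finite, simple and undirected. For vertex sets $X, Y$, $m(X)$ is the number of edges with both endpoints in $X$ and $m(X,Y)$ is the number of edges with one endpoint in $X$ and the other in $Y$. For $S \subseteq V$, $\mathrm{cov}_{\alpha}(S) = (1-\alpha)\cdot m(S) + \alpha \cdot m(S, V \setminus S)$. Max $\alpha$-FCGP asks, given $G$ and $k$, for a set of exactly $k$ vertices maximizing $\mathrm{cov}_\alpha$. *)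

theory Defs
  imports Complex_Main
begin

section \<open>Graphs and the objective function\<close>

definition simple_graph :: "'a set \<Rightarrow> 'a set set \<Rightarrow> bool" where
  "simple_graph V E \<longleftrightarrow> finite V \<and> (\<forall>e\<in>E. e \<subseteq> V \<and> card e = 2)"

definition edges_within :: "'a set set \<Rightarrow> 'a set \<Rightarrow> nat" where
  "edges_within E X = card {e \<in> E. e \<subseteq> X}"

definition edges_between :: "'a set set \<Rightarrow> 'a set \<Rightarrow> 'a set \<Rightarrow> nat" where
  "edges_between E X Y = card {e \<in> E. \<exists>x\<in>X. \<exists>y\<in>Y. e = {x, y}}"

definition cov :: "real \<Rightarrow> 'a set \<Rightarrow> 'a set set \<Rightarrow> 'a set \<Rightarrow> real" where
  "cov \<alpha> V E S =
     (1 - \<alpha>) * real (edges_within E S) + \<alpha> * real (edges_between E S (V - S))"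

text \<open>The maximum ranges over a finite set, which is nonempty iff \<open>k \<le> card V\<close>.\<close>

definition opt :: "real \<Rightarrow> 'a set \<Rightarrow> 'a set set \<Rightarrow> nat \<Rightarrow> real" where
  "opt \<alpha> V E k = Max (cov \<alpha> V E ` {S. S \<subseteq> V \<and> card S = k})"


section \<open>Machine model\<close>

text \<open>
  Algorithms are programs of a small imperative language over a random access machine:
  natural number variables, arrays of natural numbers with indirect addressing, and real
  variables, with unit cost per executed command and per evaluated guard.

  The only arithmetic is addition and subtraction (truncated on the naturals). With unit-cost
  multiplication, numbers of exponential bit length would arise in polynomially many steps; with
  addition and subtraction alone, a unit-cost machine over the naturals is polynomially equivalent
  to a Turing machine. Reals are needed because the parameters \<open>\<alpha>\<close> and \<open>\<epsilon>\<close> are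
  real; they can be added, subtracted and compared, but there are no real literals,
  no multiplication, no rounding and no real-valued arrays.

  The input graph is a read-only adjacency matrix, consulted by the guard \<open>Adj\<close>.
\<close>

type_synonym vname = string

datatype nexp =
    NConst nat
  | NVar vname
  | NAdd nexp nexp
  | NSub nexp nexp
  | NRead vname nexp  \<comment> \<open>array cell\<close>

datatype rexp =
    ROfNat nexp
  | RVar vname
  | RAdd rexp rexp
  | RSub rexp rexp

datatype bexp =
    NLess nexp nexp
  | RLess rexp rexp
  | Adj nexp nexp
  | BNot bexp
  | BAnd bexp bexp

datatype com =
    Skip
  | NAssign vname nexp
  | NWrite vname nexp nexp  \<comment> \<open>array, index, value\<close>
  | RAssign vname rexp
  | Seq com com
  | Cond bexp com com
  | While bexp com

record state =
  nvars :: "vname \<Rightarrow> nat"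
  arrs :: "vname \<Rightarrow> nat \<Rightarrow> nat"
  rvars :: "vname \<Rightarrow> real"

primrec nval :: "nexp \<Rightarrow> state \<Rightarrow> nat" where
  "nval (NConst m) s = m"
| "nval (NVar x) s = nvars s x"
| "nval (NAdd a b) s = nval a s + nval b s"
| "nval (NSub a b) s = nval a s - nval b s"
| "nval (NRead A a) s = arrs s A (nval a s)"

primrec rval :: "rexp \<Rightarrow> state \<Rightarrow> real" where
  "rval (ROfNat a) s = real (nval a s)"
| "rval (RVar x) s = rvars s x"
| "rval (RAdd a b) s = rval a s + rval b s"
| "rval (RSub a b) s = rval a s - rval b s"

primrec bval :: "nat set set \<Rightarrow> bexp \<Rightarrow> state \<Rightarrow> bool" where
  "bval E (NLess a b) s = (nval a s < nval b s)"
| "bval E (RLess a b) s = (rval a s < rval b s)"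
| "bval E (Adj a b) s = ({nval a s, nval b s} \<in> E)"
| "bval E (BNot b) s = (\<not> bval E b s)"
| "bval E (BAnd b c) s = (bval E b s \<and> bval E c s)"

text \<open>
  \<open>exec E c s t s'\<close>: on input graph \<open>E\<close>, the program \<open>c\<close> started in \<open>s\<close> halts in state
  \<open>s'\<close> after exactly \<open>t\<close> steps. Evaluating the expressions in one command is charged
  one step; their size is a constant of the program.
\<close>

inductive exec :: "nat set set \<Rightarrow> com \<Rightarrow> state \<Rightarrow> nat \<Rightarrow> state \<Rightarrow> bool" for E where
  Skip: "exec E Skip s 1 s"
| NAssign: "exec E (NAssign x a) s 1 (s\<lparr>nvars := (nvars s)(x := nval a s)\<rparr>)"
| NWrite: "exec E (NWrite A a b) s 1
             (s\<lparr>arrs := (arrs s)(A := (arrs s A)(nval a s := nval b s))\<rparr>)"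
| RAssign: "exec E (RAssign x r) s 1 (s\<lparr>rvars := (rvars s)(x := rval r s)\<rparr>)"
| Seq: "exec E c1 s t1 s1 \<Longrightarrow> exec E c2 s1 t2 s2 \<Longrightarrow> exec E (Seq c1 c2) s (t1 + t2) s2"
| CondTrue: "bval E b s \<Longrightarrow> exec E c1 s t s' \<Longrightarrow> exec E (Cond b c1 c2) s (1 + t) s'"
| CondFalse: "\<not> bval E b s \<Longrightarrow> exec E c2 s t s' \<Longrightarrow> exec E (Cond b c1 c2) s (1 + t) s'"
| WhileFalse: "\<not> bval E b s \<Longrightarrow> exec E (While b c) s 1 s"
| WhileTrue: "bval E b s \<Longrightarrow> exec E c s t1 s1 \<Longrightarrow> exec E (While b c) s1 t2 s2 \<Longrightarrow>
     exec E (While b c) s (1 + t1 + t2) s2"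

inductive_cases exec_SkipE: "exec E Skip s t s'"
inductive_cases exec_NAssignE: "exec E (NAssign x a) s t s'"
inductive_cases exec_NWriteE: "exec E (NWrite A a b) s t s'"
inductive_cases exec_RAssignE: "exec E (RAssign x r) s t s'"
inductive_cases exec_SeqE: "exec E (Seq c1 c2) s t s'"
inductive_cases exec_CondE: "exec E (Cond b c1 c2) s t s'"
inductive_cases exec_WhileE: "exec E (While b c) s t s'"

lemma exec_deterministic:
  "exec E c s t s' \<Longrightarrow> exec E c s u s'' \<Longrightarrow> u = t \<and> s'' = s'"
proof (induction arbitrary: u s'' rule: exec.induct)
  case (Skip s)
  then show ?case by (auto elim: exec_SkipE)
next
  case (NAssign x a s)
  then show ?case by (auto elim: exec_NAssignE)
next
  case (NWrite A a b s)
  then show ?case by (auto elim: exec_NWriteE)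
next
  case (RAssign x r s)
  then show ?case by (auto elim: exec_RAssignE)
next
  case (Seq c1 s t1 s1 c2 t2 s2)
  from Seq.prems obtain t1' s1' t2' where u: "u = t1' + t2'"
    and e: "exec E c1 s t1' s1'" "exec E c2 s1' t2' s''"
    by (rule exec_SeqE)
  have 1: "t1' = t1 \<and> s1' = s1" using e(1) by (rule Seq.IH(1))
  then have "exec E c2 s1 t2' s''" using e(2) by simp
  then have "t2' = t2 \<and> s'' = s2" by (rule Seq.IH(2))
  with 1 u show ?case by simp
next
  case (CondTrue b s c1 t s' c2)
  from CondTrue.prems CondTrue.hyps(1) obtain t' where "u = Suc t'" and e: "exec E c1 s t' s''"
    by (auto elim: exec_CondE)
  with CondTrue.IH[OF e] show ?case by simp
next
  case (CondFalse b s c2 t s' c1)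
  from CondFalse.prems CondFalse.hyps(1) obtain t' where "u = Suc t'" and e: "exec E c2 s t' s''"
    by (auto elim: exec_CondE)
  with CondFalse.IH[OF e] show ?case by simp
next
  case (WhileFalse b s c)
  from WhileFalse.prems WhileFalse.hyps show ?case by (auto elim: exec_WhileE)
next
  case (WhileTrue b s c t1 s1 t2 s2)
  from WhileTrue.prems WhileTrue.hyps(1) obtain t1' s1' t2' where u: "u = Suc (t1' + t2')"
    and e: "exec E c s t1' s1'" "exec E (While b c) s1' t2' s''"
    by (auto elim: exec_WhileE)
  have 1: "t1' = t1 \<and> s1' = s1" using e(1) by (rule WhileTrue.IH(1))
  then have "exec E (While b c) s1 t2' s''" using e(2) by simp
  then have "t2' = t2 \<and> s'' = s2" by (rule WhileTrue.IH(2))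
  with 1 u show ?case by simp
qed


section \<open>Approximation schemes\<close>

definition input_state :: "nat \<Rightarrow> nat \<Rightarrow> real \<Rightarrow> real \<Rightarrow> state" where
  "input_state n k \<alpha> \<epsilon> =
     \<lparr>nvars = (\<lambda>x. 0)(''n'' := n, ''k'' := k),
      arrs = (\<lambda>A i. 0),
      rvars = (\<lambda>x. 0)(''alpha'' := \<alpha>, ''eps'' := \<epsilon>)\<rparr>"

text \<open>The computed set is the support of the array \<open>S\<close> (its characteristic vector).\<close>

definition output_set :: "state \<Rightarrow> nat set" where
  "output_set s = {v. arrs s ''S'' v \<noteq> 0}"

text \<open>
  \<open>P\<close> is an approximation scheme for Max \<open>\<alpha>\<close>-FCGP with running time
  \<open>(1/\<epsilon>)\<^bsup>O(k)\<^esup> \<cdot> n\<^bsup>O(1)\<^esup>\<close>. As a program input, a graph on \<open>n\<close> vertices has vertex set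
  \<open>{..<n}\<close>. The multiplicative constant \<open>C\<close> and the \<open>max 1 n\<close> only matter for \<open>n \<le> 1\<close>.
\<close>

definition max_fcgp_approx_scheme :: "real \<Rightarrow> com \<Rightarrow> bool" where
  "max_fcgp_approx_scheme \<alpha> P \<longleftrightarrow>
     (\<exists>(C::real) (a::nat) (b::nat). \<forall>(n::nat) (E::nat set set) (k::nat) (\<epsilon>::real).
        simple_graph {..<n} E \<longrightarrow> k \<le> n \<longrightarrow> 0 < \<epsilon> \<longrightarrow> \<epsilon> < 1 \<longrightarrow>
        (\<exists>t s. exec E P (input_state n k \<alpha> \<epsilon>) t s
           \<and> real t \<le> C * (1 / \<epsilon>) ^ (a * k) * real (max 1 n) ^ b
           \<and> output_set s \<subseteq> {..<n}
           \<and> card (output_set s) = k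
           \<and> cov \<alpha> {..<n} E (output_set s) \<ge> (1 - \<epsilon>) * opt \<alpha> {..<n} E k))"

end

theory Submission
  imports Defs
begin

text \<open>
  Write \<open>cov(S) = \<alpha> d(S) - (3\<alpha> - 1) m(S)\<close>, where \<open>d(S)\<close> is the degree sum of \<open>S\<close>; the coefficient
  \<open>3\<alpha> - 1\<close> lies between \<open>0\<close> and \<open>2\<alpha>\<close>.

  Summing the change of \<open>cov\<close> over suitable sets of swaps \<open>S - a + b\<close> shows two things. A \<open>k\<close>-set
  that no swap improves is a \<open>1/3\<close>-approximation; since \<open>cov\<close> takes only polynomially many values,
  local search finds one in polynomial time, which settles \<open>\<epsilon> \<ge> 2/3\<close>, where a factor \<open>c\<^sup>k\<close> in the running time
  is not affordable. And if \<open>2k \<le> n\<close>, an optimal set satisfies \<open>d(S) \<le> 4 cov(S)\<close>.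

  For \<open>\<epsilon> < 2/3\<close> let \<open>T\<close> consist of the \<open>kL\<close> vertices of highest degree, \<open>L \<approx> 9/\<epsilon>\<close>. The vertices
  of an optimal set outside \<open>T\<close> are replaced one at a time by vertices of \<open>T\<close> with as few
  neighbours in the current set as possible. Degrees do not decrease, and by averaging each replacement loses at
  most about \<open>2\<alpha> d(S)/(kL)\<close>, in total \<open>O(d(S)/L)\<close>, which is at most \<open>\<epsilon> \<sqdot> OPT\<close>. Hence it
  suffices to try all \<open>k\<close>-subsets of \<open>T\<close>, and \<open>T\<close> has at most \<open>(3L)\<^sup>k\<close> subsets of size at most \<open>k\<close>.
\<close>

section \<open>Swapping vertices\<close>

definition adj :: "'a set set \<Rightarrow> 'a \<Rightarrow> 'a \<Rightarrow> real" where
  "adj E x y = of_bool ({x, y} \<in> E)"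

text \<open>Counting ordered pairs makes this symmetric and additive over disjoint unions in each
  argument; the price is the factor 2 in \<open>arcs_within\<close>.\<close>

definition arcs :: "'a set set \<Rightarrow> 'a set \<Rightarrow> 'a set \<Rightarrow> real" where
  "arcs E X Y = (\<Sum>x\<in>X. \<Sum>y\<in>Y. adj E x y)"

lemma adj_commute: "adj E x y = adj E y x"
  by (simp add: adj_def insert_commute)

lemma adj_nonneg [simp]: "0 \<le> adj E x y"
  by (simp add: adj_def)

lemma arcs_nonneg [simp]: "0 \<le> arcs E X Y"
  by (simp add: arcs_def sum_nonneg)

lemma arcs_commute: "arcs E X Y = arcs E Y X"
  unfolding arcs_def by (subst sum.swap) (simp add: adj_commute)

lemma arcs_Un_right:
  "finite Y \<Longrightarrow> finite Z \<Longrightarrow> Y \<inter> Z = {} \<Longrightarrow> arcs E X (Y \<union> Z) = arcs E X Y + arcs E X Z"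
  by (simp add: arcs_def sum.union_disjoint sum.distrib)

lemma arcs_Un_left:
  "finite Y \<Longrightarrow> finite Z \<Longrightarrow> Y \<inter> Z = {} \<Longrightarrow> arcs E (Y \<union> Z) X = arcs E Y X + arcs E Z X"
  by (simp add: arcs_commute [of E _ X] arcs_Un_right)

lemma arcs_mono_right: "finite Z \<Longrightarrow> Y \<subseteq> Z \<Longrightarrow> arcs E X Y \<le> arcs E X Z"
  by (auto simp: arcs_def intro!: sum_mono sum_mono2)

lemma sum_arcs_left: "(\<Sum>x\<in>X. arcs E {x} Y) = arcs E X Y"
  by (simp add: arcs_def)

locale fcgp =
  fixes V :: "'a set" and E :: "'a set set" and \<alpha> :: real
  assumes graph: "simple_graph V E" and alpha: "1 / 3 \<le> \<alpha>" "\<alpha> \<le> 1"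
begin

abbreviation f :: "'a set \<Rightarrow> real" where "f \<equiv> cov \<alpha> V E"
abbreviation \<beta> :: real where "\<beta> \<equiv> 3 * \<alpha> - 1"
abbreviation degs :: "'a set \<Rightarrow> real" where "degs S \<equiv> arcs E S V"

section \<open>Edge counts and coverage in terms of arcs\<close>

lemma finite_V [simp]: "finite V"
  using graph by (simp add: simple_graph_def)

lemma finite_sub: "S \<subseteq> V \<Longrightarrow> finite S"
  by (rule finite_subset [OF _ finite_V])

lemma finite_E: "finite E"
  by (rule finite_subset [of _ "Pow V"]) (use graph in \<open>auto simp: simple_graph_def\<close>)

lemma adj_self [simp]: "adj E x x = 0"
  using graph by (auto simp: adj_def simple_graph_def)

text \<open>Fibre count: every edge has two distinct endpoints, so exactly the pairs
  \<open>(x, y)\<close> and \<open>(y, x)\<close> are sent to it.\<close>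

lemma arcs_within:
  assumes "finite S"
  shows "arcs E S S = 2 * real (edges_within E S)"
proof -
  let ?W = "{e \<in> E. e \<subseteq> S}"
  let ?P = "{p \<in> S \<times> S. {fst p, snd p} \<in> E}"
  have eq: "?P = (\<Union>e\<in>?W. {p. {fst p, snd p} = e})"
  proof (intro equalityI subsetI)
    fix p assume "p \<in> ?P"
    then have "{fst p, snd p} \<in> ?W" by (simp add: mem_Times_iff)
    then show "p \<in> (\<Union>e\<in>?W. {p. {fst p, snd p} = e})" by blast
  next
    fix p assume "p \<in> (\<Union>e\<in>?W. {p. {fst p, snd p} = e})"
    then have "{fst p, snd p} \<in> ?W" by blast
    then show "p \<in> ?P" by (simp add: mem_Times_iff)
  qed
  have two: "finite {p. {fst p, snd p} = e} \<and> card {p. {fst p, snd p} = e} = 2" if "e \<in> ?W" for e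
  proof -
    have "card e = 2" using that graph by (auto simp: simple_graph_def)
    then obtain x y where e: "e = {x, y}" "x \<noteq> y" by (auto simp: card_2_iff)
    then have "{p. {fst p, snd p} = e} = {(x, y), (y, x)}"
      by (auto simp: doubleton_eq_iff)
    with e show ?thesis by simp
  qed
  have "card ?P = (\<Sum>e\<in>?W. card {p. {fst p, snd p} = e})"
    unfolding eq using two finite_E by (intro card_UN_disjoint) auto
  also have "\<dots> = 2 * card ?W" using two by simp
  finally have "real (card ?P) = 2 * real (edges_within E S)" by (simp add: edges_within_def)
  moreover have "arcs E S S = (\<Sum>p\<in>S \<times> S. of_bool ({fst p, snd p} \<in> E))"
    by (simp add: arcs_def sum.cartesian_product adj_def case_prod_unfold)
  moreover have "\<dots> = real (card ?P)" using assms by (simp add: Int_def)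
  ultimately show ?thesis by simp
qed

text \<open>Here the orientation is forced, the first component being the endpoint in
  \<open>S\<close>, so pairs and edges correspond one to one.\<close>

lemma arcs_between:
  assumes "S \<subseteq> V"
  shows "arcs E S (V - S) = real (edges_between E S (V - S))"
proof -
  let ?P = "{p \<in> S \<times> (V - S). {fst p, snd p} \<in> E}"
  have "bij_betw (\<lambda>p. {fst p, snd p}) ?P {e \<in> E. \<exists>x\<in>S. \<exists>y\<in>V - S. e = {x, y}}"
  proof (rule bij_betwI')
    fix e assume "e \<in> {e \<in> E. \<exists>x\<in>S. \<exists>y\<in>V - S. e = {x, y}}"
    then obtain x y where "x \<in> S" "y \<in> V - S" "e = {x, y}" "e \<in> E" by auto
    then show "\<exists>p\<in>?P. e = {fst p, snd p}" by (intro bexI [of _ "(x, y)"]) auto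
  qed (force simp: doubleton_eq_iff)+
  then have "card ?P = edges_between E S (V - S)"
    unfolding edges_between_def by (rule bij_betw_same_card)
  moreover have "arcs E S (V - S) = (\<Sum>p\<in>S \<times> (V - S). of_bool ({fst p, snd p} \<in> E))"
    unfolding arcs_def sum.cartesian_product adj_def case_prod_unfold ..
  moreover have "\<dots> = real (card ?P)" using finite_sub [OF assms] by (simp add: Int_def)
  ultimately show ?thesis by simp
qed

lemma arcs_split: "S \<subseteq> V \<Longrightarrow> arcs E X V = arcs E X S + arcs E X (V - S)"
  using arcs_Un_right [of S "V - S" E X] finite_sub by (simp add: Un_absorb1)

lemma cov_arcs:
  "S \<subseteq> V \<Longrightarrow> 2 * f S = (1 - \<alpha>) * arcs E S S + 2 * \<alpha> * arcs E S (V - S)"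
  by (simp add: cov_def arcs_within arcs_between finite_sub algebra_simps)

text \<open>Eliminating \<open>arcs E S (V - S)\<close> leaves a linear degree term and a penalty
  for internal edges, which \<open>arcs E S S\<close> counts twice. The bound
  \<open>1 / 3 \<le> \<alpha>\<close> makes the weight \<open>\<beta> / 2\<close> of the penalty
  nonnegative.\<close>

lemma cov_degs: "S \<subseteq> V \<Longrightarrow> f S = \<alpha> * degs S - \<beta> / 2 * arcs E S S"
  using cov_arcs [of S] arcs_split [of S S] by (simp add: field_simps)

lemma cov_nonneg: "0 \<le> f S"
  using alpha by (simp add: cov_def)

lemma arcs_insert_remove:
  assumes "finite S" "a \<in> S" "b \<notin> S"
  shows "arcs E (insert b (S - {a})) X = arcs E S X - arcs E {a} X + arcs E {b} X"
proof -
  have "arcs E ((S - {a}) \<union> {b}) X = arcs E (S - {a}) X + arcs E {b} X"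
    using assms by (intro arcs_Un_left) auto
  moreover have "arcs E ((S - {a}) \<union> {a}) X = arcs E (S - {a}) X + arcs E {a} X"
    using assms by (intro arcs_Un_left) auto
  moreover have "(S - {a}) \<union> {a} = S" using assms by auto
  ultimately show ?thesis by simp
qed

text \<open>The new vertex \<open>b\<close> meets \<open>S\<close> without \<open>a\<close>, whence
  the correction \<open>adj E a b\<close> to its number of neighbours.\<close>

lemma cov_swap:
  assumes "S \<subseteq> V" "a \<in> S" "b \<in> V" "b \<notin> S"
  shows "f (insert b (S - {a})) - f S =
    \<alpha> * (degs {b} - degs {a}) - \<beta> * (arcs E {b} S - adj E a b - arcs E {a} S)"
proof -
  let ?S = "insert b (S - {a})"
  have fin: "finite S" using assms finite_sub by blast
  have 1: "arcs E ?S X = arcs E S X - arcs E {a} X + arcs E {b} X" for X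
    by (rule arcs_insert_remove) (use fin assms in auto)
  have 2: "arcs E X ?S = arcs E X S - arcs E X {a} + arcs E X {b}" for X
    using 1 [of X] by (simp add: arcs_commute)
  have 3: "arcs E {a} {b} = adj E a b" "arcs E {b} {a} = adj E a b"
    "arcs E {a} {a} = 0" "arcs E {b} {b} = 0"
    by (simp_all add: arcs_def adj_commute)
  have 4: "arcs E ?S ?S = arcs E S S + 2 * arcs E {b} S - 2 * arcs E {a} S - 2 * adj E a b"
    by (simp add: 1 2 3 arcs_commute [of E S "{a}"] arcs_commute [of E S "{b}"])
  have "?S \<subseteq> V" using assms by auto
  then show ?thesis
    using assms(1) by (simp add: cov_degs 1 [of V] 4 field_simps)
qed

section \<open>Sets that no swap improves\<close>

definition swap_opt :: "'a set \<Rightarrow> bool" where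
  "swap_opt S \<longleftrightarrow> (\<forall>a\<in>S. \<forall>b\<in>V - S. f (insert b (S - {a})) \<le> f S)"

text \<open>Adds up the inequalities of all swaps between two blocks: a summand that depends on one
  of the two vertices only is multiplied by the size of the other block. The two estimates below are
  instances of this one.\<close>

lemma swap_opt_sum:
  assumes "swap_opt S" "S \<subseteq> V" "A \<subseteq> S" "B \<subseteq> V - S"
  shows "\<alpha> * (card A * degs B - card B * degs A)
    \<le> \<beta> * (card A * arcs E S B - arcs E A B - card B * arcs E A S)"
proof -
  have "(\<Sum>a\<in>A. \<Sum>b\<in>B. \<alpha> * (degs {b} - degs {a}) - \<beta> * (arcs E {b} S - adj E a b - arcs E {a} S)) \<le> 0"
  proof (intro sum_nonpos)
    fix a b assume "a \<in> A" "b \<in> B"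
    then have ab: "a \<in> S" "b \<in> V" "b \<notin> S" using assms by auto
    then have "f (insert b (S - {a})) \<le> f S" using assms(1) by (auto simp: swap_opt_def)
    then show "\<alpha> * (degs {b} - degs {a}) - \<beta> * (arcs E {b} S - adj E a b - arcs E {a} S) \<le> 0"
      using cov_swap [OF assms(2) ab] by simp
  qed
  moreover have "(\<Sum>a\<in>A. \<Sum>b\<in>B. \<alpha> * (degs {b} - degs {a}) - \<beta> * (arcs E {b} S - adj E a b - arcs E {a} S))
    = \<alpha> * (card A * degs B - card B * degs A)
    - \<beta> * (card A * arcs E B S - arcs E A B - card B * arcs E A S)"
    by (simp add: sum_subtractf sum.distrib sum_arcs_left flip: sum_distrib_left sum_distrib_right)
       (simp add: arcs_def)
  ultimately show ?thesis by (simp add: arcs_commute [of E S B])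
qed

text \<open>Sum over the swaps between \<open>S - R\<close> and \<open>R - S\<close>.\<close>

lemma swap_opt_approx:
  assumes "swap_opt S" "S \<subseteq> V" "R \<subseteq> V" "card R = card S"
  shows "f R \<le> 3 * f S"
proof (cases "R = S")
  case True
  have "f S \<le> 3 * f S" using cov_nonneg [of S] by linarith
  then show ?thesis unfolding True .
next
  case False
  define A B I where "A = S - R" and "B = R - S" and "I = S \<inter> R"
  have finSR: "finite S" "finite R"
    using assms finite_sub by blast+
  then have fin: "finite A" "finite B" "finite I" "finite S" "finite R"
    by (simp_all add: A_def B_def I_def)
  have S: "S = A \<union> I" and R: "R = B \<union> I" and dis: "A \<inter> I = {}" "B \<inter> I = {}"
    by (auto simp: A_def B_def I_def)
  have "card A + card I = card B + card I"
    using fin dis assms(4) unfolding S R by (simp add: card_Un_disjoint)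
  then have card: "card B = card A" by simp
  have "card A \<noteq> 0"
    using False fin card S R by auto
  then have p: "real (card A) > 0" by simp
  have b0: "0 \<le> \<beta>" "\<beta> \<le> 2 * \<alpha>" using alpha by auto
  have "\<alpha> * (card A * degs B - card A * degs A)
    \<le> \<beta> * (card A * arcs E S B - arcs E A B - card A * arcs E A S)"
    using swap_opt_sum [OF assms(1,2), of A B] assms(3) card by (auto simp: A_def B_def)
  \<comment> \<open>Dropping \<open>- arcs E A B\<close> leaves the common factor
    \<open>card A\<close>, which is positive and cancels.\<close>
  also have "\<dots> \<le> \<beta> * (card A * arcs E S B - card A * arcs E A S)"
    using b0 by (intro mult_left_mono) auto
  finally have "card A * (\<alpha> * (degs B - degs A)) \<le> card A * (\<beta> * (arcs E S B - arcs E A S))"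
    by (simp add: algebra_simps)
  then have 1: "\<alpha> * (degs B - degs A) \<le> \<beta> * (arcs E S B - arcs E A S)"
    using p by simp
  have un: "arcs E S X = arcs E A X + arcs E I X" "arcs E R X = arcs E B X + arcs E I X"
    "arcs E X S = arcs E X A + arcs E X I" "arcs E X R = arcs E X B + arcs E X I" for X
    using S R fin dis arcs_Un_left arcs_Un_right by metis+
  have com: "arcs E I A = arcs E A I" "arcs E I B = arcs E B I" "arcs E B A = arcs E A B"
    by (rule arcs_commute)+
  have 2: "f R - f S = \<alpha> * (degs B - degs A) - \<beta> / 2 * (arcs E R R - arcs E S S)"
    using assms by (simp add: cov_degs un(1,2) [of V]) (simp add: field_simps)
  \<comment> \<open>After expanding \<open>S\<close> as \<open>A \<union> I\<close> and
    \<open>R\<close> as \<open>B \<union> I\<close>, all terms that involve \<open>I\<close>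
    cancel.\<close>
  have "f R - f S \<le> \<beta> * (arcs E A B - arcs E A A / 2 - arcs E B B / 2)"
    using 1 unfolding 2 un com by (simp add: field_simps)
  also have "\<dots> \<le> \<beta> * arcs E A B"
    using b0(1) arcs_nonneg [of E A A] arcs_nonneg [of E B B] by (intro mult_left_mono) linarith+
  also have "\<dots> \<le> 2 * \<alpha> * arcs E A B" using b0 by (intro mult_right_mono) auto
  \<comment> \<open>What remains joins \<open>A\<close>, inside \<open>S\<close>, to
    \<open>B\<close>, outside \<open>S\<close>. These are cut edges of \<open>S\<close>, and each
    contributes \<open>\<alpha>\<close> to \<open>f S\<close>; so the deficit is at most
    \<open>2 * f S\<close>.\<close>
  also have "\<dots> \<le> 2 * \<alpha> * arcs E S (V - S)"
  proof -
    have "arcs E A B \<le> arcs E S B" by (simp add: un)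
    also have "\<dots> \<le> arcs E S (V - S)" using assms by (intro arcs_mono_right) (auto simp: B_def)
    finally show ?thesis using alpha by simp
  qed
  also have "\<dots> \<le> 2 * f S"
    using cov_arcs [OF assms(2)] alpha by simp
  finally show ?thesis by simp
qed

text \<open>Sum over all swaps.\<close>

lemma swap_opt_degs:
  assumes "swap_opt S" "S \<subseteq> V" "2 * card S \<le> card V"
  shows "degs S \<le> 4 * f S"
proof (cases "S = {}")
  case True
  then show ?thesis using cov_nonneg by (simp add: arcs_def)
next
  case False
  define k r c m where "k = real (card S)" and "r = real (card (V - S))"
    and "c = arcs E S (V - S)" and "m = arcs E S S"
  have fin: "finite S" using assms finite_sub by blast
  have "card V = card S + card (V - S)"
    using assms fin by (simp add: card_Diff_subset card_mono)
  then have kr: "k \<le> r" "1 \<le> k" using assms False fin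
    by (auto simp: k_def r_def Suc_le_eq card_gt_0_iff)
  have d: "degs S = m + c" "c \<le> degs (V - S)"
    using arcs_split [OF assms(2), of S] arcs_split [OF assms(2), of "V - S"]
    by (auto simp: c_def m_def arcs_commute)
  have pos: "0 \<le> c" "0 \<le> m" by (auto simp: c_def m_def)
  have "\<alpha> * (k * degs (V - S) - r * degs S) \<le> \<beta> * (k * c - c - r * m)"
    using swap_opt_sum [OF assms(1,2), of S "V - S"] by (simp add: k_def r_def c_def m_def)
  moreover have "\<alpha> * (k * c) \<le> \<alpha> * (k * degs (V - S))"
    using d kr alpha by (intro mult_left_mono) auto
  \<comment> \<open>This uses \<open>k \<le> r\<close>, that is
    \<open>2 * card S \<le> card V\<close>. Every surviving term now has the factor
    \<open>r\<close>, which is cancelled.\<close>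
  moreover have "\<beta> * (k * c - c) \<le> \<beta> * (r * c)"
    using kr pos alpha by (intro mult_left_mono) (auto intro: order_trans [of _ "k * c"] mult_right_mono)
  moreover have "0 \<le> \<alpha> * (k * c)" using alpha kr pos by simp
  ultimately have "- (r * (\<alpha> * degs S)) \<le> r * (\<beta> * c) - r * (\<beta> * m)"
    by (simp add: algebra_simps)
  then have "r * (\<beta> * m - \<alpha> * degs S) \<le> r * (\<beta> * c)"
    by (simp add: algebra_simps)
  then have "\<beta> * m - \<alpha> * degs S \<le> \<beta> * c" using kr by simp
  \<comment> \<open>With \<open>degs S = m + c\<close> the inequality reads
    \<open>(2 * \<alpha> - 1) * m \<le> (4 * \<alpha> - 1) * c\<close>. This is the claim, since
    \<open>4 * f S = 2 * (1 - \<alpha>) * m + 4 * \<alpha> * c\<close>.\<close>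
  then show ?thesis
    using cov_arcs [OF assms(2)] unfolding d
    by (simp add: algebra_simps flip: c_def m_def)
qed

text \<open>At least \<open>w\<close> vertices of \<open>T\<close> are free at each replacement.
  Losses are charged to the degree sum of the final set, which dominates those of all intermediate
  sets. Since that sum may be far larger than \<open>degs S\<close>, the gain
  \<open>\<alpha> * (degs S' - degs S)\<close> is kept in the bound to pay for it.\<close>

lemma exchange_into:
  assumes "T \<subseteq> V" and top: "\<And>x y. x \<in> T \<Longrightarrow> y \<in> V - T \<Longrightarrow> degs {y} \<le> degs {x}"
    and "S \<subseteq> V" "0 < w" "card S + w \<le> card T"
  shows "\<exists>S'. S' \<subseteq> T \<and> card S' = card S \<and> degs S \<le> degs S' \<and>
    f S + \<alpha> * (degs S' - degs S) - 2 * \<alpha> * card (S - T) / w * degs S' \<le> f S'"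
  using assms(3-)
proof (induction "card (S - T)" arbitrary: S)
  case 0
  have "finite S" using 0 by (intro finite_sub)
  then have "S \<subseteq> T" using 0(1) by simp
  then show ?case using 0(1) by (intro exI [of _ S]) simp
next
  case (Suc u)
  then have "S - T \<noteq> {}" by force
  then obtain y where y: "y \<in> S" "y \<notin> T" by blast
  have fin: "finite S" "finite T" using Suc.prems(1) assms(1) finite_sub by blast+
  have b0: "0 \<le> \<beta>" "\<beta> \<le> 2 * \<alpha>" using alpha by auto
  have "card T - card S \<le> card (T - S)" using fin by (simp add: diff_card_le_card_Diff)
  then have w: "w \<le> card (T - S)" using Suc by simp
  \<comment> \<open>Averaging: otherwise the vertices of \<open>T - S\<close>, at least
    \<open>w\<close> in number, would together receive more than \<open>degs S\<close> arcs from
    \<open>S\<close>.\<close>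
  have "\<exists>x\<in>T - S. arcs E {x} S \<le> degs S / w"
  proof (rule ccontr)
    assume "\<not> ?thesis"
    then have *: "degs S / w \<le> arcs E {x} S" "degs S / w < arcs E {x} S" if "x \<in> T - S" for x
      using that by force+
    have "degs S \<le> card (T - S) * (degs S / w)"
      using w \<open>0 < w\<close> mult_right_mono [of "real w" "real (card (T - S))" "degs S"]
      by (simp add: field_simps)
    also have "\<dots> < (\<Sum>x\<in>T - S. arcs E {x} S)"
    proof -
      have "T - S \<noteq> {}" using w \<open>0 < w\<close> by force
      then have "(\<Sum>x\<in>T - S. degs S / w) < (\<Sum>x\<in>T - S. arcs E {x} S)"
        using fin * by (intro sum_strict_mono) auto
      then show ?thesis by simp
    qed
    also have "\<dots> = arcs E S (T - S)" unfolding sum_arcs_left by (rule arcs_commute)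
    also have "\<dots> \<le> degs S" using assms by (intro arcs_mono_right) auto
    finally show False by simp
  qed
  then obtain x where x: "x \<in> T" "x \<notin> S" "arcs E {x} S \<le> degs S / w" by auto
  let ?S = "insert x (S - {y})"
  have sub: "?S \<subseteq> V" using Suc assms x by auto
  have "?S - T = (S - T) - {y}" using x by auto
  then have u: "u = card (?S - T)" using Suc y fin by simp
  have cS: "card ?S = card S" using x y fin card_gt_0_iff [of S] by auto
  have D: "degs ?S = degs S - degs {y} + degs {x}"
    by (rule arcs_insert_remove) (use fin x y in auto)
  have xy: "degs {y} \<le> degs {x}" using top x y Suc by auto
  have "f ?S - f S = \<alpha> * (degs {x} - degs {y}) - \<beta> * (arcs E {x} S - adj E y x - arcs E {y} S)"
    by (rule cov_swap) (use Suc assms x y in auto)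
  moreover have "\<beta> * (arcs E {x} S - adj E y x - arcs E {y} S) \<le> \<beta> * (degs S / w)"
  proof (intro mult_left_mono b0)
    have "0 \<le> adj E y x" "0 \<le> arcs E {y} S" by simp_all
    then show "arcs E {x} S - adj E y x - arcs E {y} S \<le> degs S / w" using x(3) by linarith
  qed
  moreover have "\<beta> * (degs S / w) \<le> 2 * \<alpha> * (degs S / w)"
    using b0 by (intro mult_right_mono) auto
  ultimately have 1: "f S + \<alpha> * (degs ?S - degs S) - 2 * \<alpha> * (degs S / w) \<le> f ?S"
    unfolding D by simp
  obtain S' where S': "S' \<subseteq> T" "card S' = card ?S" "degs ?S \<le> degs S'"
    "f ?S + \<alpha> * (degs S' - degs ?S) - 2 * \<alpha> * card (?S - T) / w * degs S' \<le> f S'"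
    using Suc(1) [OF u sub] Suc cS by auto
  have "degs S \<le> degs S'" using S'(3) xy D by simp
  moreover have "2 * \<alpha> * (degs S / w) \<le> 2 * \<alpha> * (degs S' / w)"
    using alpha calculation by (intro mult_left_mono divide_right_mono) auto
  moreover have "2 * \<alpha> * card (S - T) / w * degs S' =
     2 * \<alpha> * (degs S' / w) + 2 * \<alpha> * card (?S - T) / w * degs S'"
  proof -
    have "real (card (S - T)) = 1 + real (card (?S - T))" using Suc(2) u by simp
    then show ?thesis using \<open>0 < w\<close> by (simp only:) (simp add: field_simps)
  qed
  ultimately have "f S + \<alpha> * (degs S' - degs S) - 2 * \<alpha> * card (S - T) / w * degs S' \<le> f S'"
    using 1 S'(4) by (simp add: algebra_simps)
  then show ?case using S' cS \<open>degs S \<le> degs S'\<close> by auto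
qed

section \<open>Comparison with the optimum\<close>

lemma cov_le_opt: "S \<subseteq> V \<Longrightarrow> card S = k \<Longrightarrow> f S \<le> opt \<alpha> V E k"
  unfolding opt_def by (rule Max_ge) (auto intro: finite_subset [of _ "f ` Pow V"])

lemma opt_attained:
  assumes "k \<le> card V"
  obtains S where "S \<subseteq> V" "card S = k" "opt \<alpha> V E k = f S"
proof -
  have "opt \<alpha> V E k \<in> f ` {S. S \<subseteq> V \<and> card S = k}"
    unfolding opt_def
  proof (rule Max_in)
    show "finite (f ` {S. S \<subseteq> V \<and> card S = k})" by (auto intro: finite_subset [of _ "f ` Pow V"])
    obtain S where "S \<subseteq> V" "card S = k" using obtain_subset_with_card_n assms by metis
    then show "f ` {S. S \<subseteq> V \<and> card S = k} \<noteq> {}" by auto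
  qed
  then show ?thesis using that by auto
qed

lemma local_approx:
  assumes "swap_opt S" "S \<subseteq> V" "card S = k"
  shows "opt \<alpha> V E k \<le> 3 * f S"
proof -
  have "k \<le> card V" using assms card_mono finite_V by metis
  then obtain R where "R \<subseteq> V" "card R = k" "opt \<alpha> V E k = f R" by (rule opt_attained)
  then show ?thesis using swap_opt_approx assms by metis
qed

text \<open>An optimal \<open>R\<close> is swap-optimal, so \<open>degs R \<le> 4 * f R\<close>, and
  moving it into \<open>T\<close> costs at most \<open>\<alpha> * \<tau> * degs R\<close> with
  \<open>\<tau> = 2 / (L - 1)\<close>. The alternatives for \<open>T\<close> cover the cases where
  \<open>T\<close> is the whole vertex set and where the set sought is empty.\<close>

lemma top_approx:
  assumes "T \<subseteq> V" and top: "\<And>x y. x \<in> T \<Longrightarrow> y \<in> V - T \<Longrightarrow> degs {y} \<le> degs {x}"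
    and T: "T = V \<or> k = 0 \<or> card T = k * L \<and> 9 \<le> L * \<epsilon>" and k: "k \<le> card V" and eps: "0 < \<epsilon>" "\<epsilon> < 1"
  shows "\<exists>S. S \<subseteq> T \<and> card S = k \<and> (1 - \<epsilon>) * opt \<alpha> V E k \<le> f S"
proof -
  obtain R where R: "R \<subseteq> V" "card R = k" "opt \<alpha> V E k = f R" using opt_attained k by metis
  have trivial: ?thesis if "R \<subseteq> T"
    using that R eps cov_nonneg [of R] by (intro exI [of _ R]) (auto intro: mult_left_le_one_le)
  show ?thesis
  proof (cases "R \<subseteq> T")
    case False
    then have "R \<noteq> {}" by blast
    then have k0: "0 < k" using R finite_sub by (metis card_gt_0_iff)
    then have cT: "card T = k * L" and L: "9 \<le> L * \<epsilon>" using False T R by auto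
    have "0 < L" using L by (cases "L = 0") auto
    then have "real L * \<epsilon> < real L * 1" using eps by (intro mult_strict_left_mono) auto
    then have "9 < real L" using L by linarith
    then have L9: "9 < L" by simp
    have "k * 2 \<le> k * L" using L9 by simp
    then have "2 * card R \<le> card T" by (simp add: cT R)
    moreover have "card T \<le> card V" using assms(1) by (simp add: card_mono)
    ultimately have k2: "2 * card R \<le> card V" by simp
    have "swap_opt R"
      unfolding swap_opt_def
    proof (intro ballI)
      fix a b assume "a \<in> R" "b \<in> V - R"
      moreover have "finite R" using R finite_sub by blast
      ultimately have "card (insert b (R - {a})) = card R" "insert b (R - {a}) \<subseteq> V"
        using R card_gt_0_iff [of R] by auto
      then show "f (insert b (R - {a})) \<le> f R" using cov_le_opt R by metis
    qed
    then have deg: "degs R \<le> 4 * f R" using swap_opt_degs R k2 by auto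
    \<comment> \<open>Of the \<open>k * L\<close> vertices of \<open>T\<close>, at least
      \<open>k * (L - 1)\<close> lie outside any given set of size \<open>k\<close>.\<close>
    define w where "w = k * (L - 1)"
    have w: "0 < w" "card R + w \<le> card T"
      using k0 L9 R cT by (auto simp: w_def algebra_simps)
    obtain S where S: "S \<subseteq> T" "card S = k" "degs R \<le> degs S"
      "f R + \<alpha> * (degs S - degs R) - 2 * \<alpha> * card (R - T) / w * degs S \<le> f S"
      using exchange_into [OF assms(1) top R(1) w] R by auto
    define \<tau> where "\<tau> = 2 * real k / w"
    have tau: "\<tau> = 2 / (real L - 1)" using k0 L9 by (simp add: \<tau>_def w_def of_nat_diff)
    \<comment> \<open>The constant 9 is chosen for the last bound:
      \<open>(L - 1) * \<epsilon> \<ge> 9 - \<epsilon> > 8\<close>, hence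
      \<open>4 * \<tau> = 8 / (L - 1) \<le> \<epsilon>\<close>.\<close>
    have tau1: "0 \<le> \<tau>" "\<tau> \<le> 1" "4 * \<tau> \<le> \<epsilon>"
      using L9 L eps by (auto simp: tau field_simps)
    have "card (R - T) \<le> k" using R finite_sub by (metis card_mono Diff_subset)
    then have "2 * \<alpha> * card (R - T) / w * degs S \<le> 2 * \<alpha> * k / w * degs S"
      using alpha by (intro mult_right_mono divide_right_mono mult_left_mono) auto
    also have "\<dots> = \<alpha> * (\<tau> * degs S)" by (simp add: \<tau>_def)
    finally have "f R + \<alpha> * ((1 - \<tau>) * degs S - degs R) \<le> f S"
      using S(4) by (simp add: algebra_simps)
    \<comment> \<open>As \<open>1 - \<tau>\<close> is nonnegative, the degree gain absorbs the
      excess loss and \<open>degs S\<close> may be replaced by the smaller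
      \<open>degs R\<close>.\<close>
    moreover have "\<alpha> * ((1 - \<tau>) * degs R - degs R) \<le> \<alpha> * ((1 - \<tau>) * degs S - degs R)"
      using S(3) tau1 alpha by (intro mult_left_mono diff_right_mono) auto
    ultimately have "f R - \<alpha> * (\<tau> * degs R) \<le> f S" by (simp add: algebra_simps)
    moreover have "\<alpha> * (\<tau> * degs R) \<le> 1 * (\<tau> * degs R)"
      using alpha tau1 by (intro mult_right_mono) auto
    moreover have "\<tau> * degs R \<le> \<tau> * (4 * f R)" using deg tau1 by (intro mult_left_mono)
    moreover have "4 * \<tau> * f R \<le> \<epsilon> * f R" using tau1 cov_nonneg by (intro mult_right_mono)
    ultimately have "(1 - \<epsilon>) * f R \<le> f S" by (simp add: algebra_simps)
    then show ?thesis using S R by auto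
  qed (rule trivial)
qed

end

section \<open>Vertices of high degree\<close>

text \<open>Each small subset \<open>U\<close> is given weight \<open>L\<^bsup>-|U|\<^esup> \<ge> L\<^bsup>-k\<^esup>\<close>; the weights of all subsets of \<open>T\<close> sum to \<open>(1 + 1/L)\<^bsup>|T|\<^esup> \<le> 3\<^sup>k\<close>.\<close>

lemma card_small_subsets:
  assumes "finite T" "card T \<le> k * L" "k = 0 \<or> 0 < L"
  shows "card {U. U \<subseteq> T \<and> card U \<le> k} \<le> (3 * L) ^ k"
proof (cases "k = 0")
  case True
  then have "{U. U \<subseteq> T \<and> card U \<le> k} = {{}}"
    using assms(1) finite_subset by fastforce
  then show ?thesis using True by simp
next
  case False
  define y where "y = 1 / real L"
  have L: "0 < real L" and y: "0 < y" "y \<le> 1" using assms False by (auto simp: y_def)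
  let ?F = "{U. U \<subseteq> T \<and> card U \<le> k}"
  have "y ^ k * card ?F = (\<Sum>U\<in>?F. y ^ k)" by simp
  also have "\<dots> \<le> (\<Sum>U\<in>?F. y ^ card U)"
    using y by (intro sum_mono power_decreasing) auto
  also have "\<dots> \<le> (\<Sum>U\<in>Pow T. y ^ card U)"
    using assms y by (intro sum_mono2) auto
  \<comment> \<open>Expansion of a product of \<open>card T\<close> factors \<open>y + 1\<close>
    over the subsets of \<open>T\<close>.\<close>
  also have "\<dots> = (1 + y) ^ card T"
    using prod_add [OF assms(1), of "\<lambda>_. y" "\<lambda>_. 1"] by (simp add: add.commute)
  also have "\<dots> \<le> (1 + y) ^ (L * k)"
    using assms(2) y by (intro power_increasing) (auto simp: mult.commute)
  also have "\<dots> \<le> 3 ^ k"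
  proof -
    have "(1 + y) ^ L \<le> exp y ^ L" using y by (intro power_mono) auto
    also have "\<dots> = exp 1" using L by (simp add: y_def flip: exp_of_nat_mult)
    finally have "(1 + y) ^ L \<le> 3" using exp_le by linarith
    then show ?thesis using y by (simp add: power_mult power_mono)
  qed
  finally have "card ?F \<le> 3 ^ k * real L ^ k"
    using L by (simp add: y_def field_simps)
  then have "real (card ?F) \<le> real ((3 * L) ^ k)"
    unfolding of_nat_power of_nat_mult power_mult_distrib by simp
  then show ?thesis unfolding of_nat_le_iff .
qed

text \<open>Ties between vertices of equal degree are broken by index.\<close>

definition ahead :: "(nat \<Rightarrow> nat) \<Rightarrow> nat \<Rightarrow> nat \<Rightarrow> bool" where
  "ahead d u v \<longleftrightarrow> d v < d u \<or> \<not> d u < d v \<and> u < v"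

text \<open>Ranks replace sorting: membership among the best \<open>N\<close> vertices becomes one
  comparison, and a rank can be computed by a single loop.\<close>

definition rank :: "(nat \<Rightarrow> nat) \<Rightarrow> nat \<Rightarrow> nat \<Rightarrow> nat" where
  "rank d n v = card {u. u < n \<and> ahead d u v}"

lemma rank_less: "v < n \<Longrightarrow> rank d n v < n"
proof -
  assume "v < n"
  then have "{u. u < n \<and> ahead d u v} \<subset> {..<n}" by (auto simp: ahead_def)
  then have "card {u. u < n \<and> ahead d u v} < card {..<n}" by (intro psubset_card_mono) auto
  then show ?thesis by (simp add: rank_def)
qed

lemma rank_mono: "u < n \<Longrightarrow> ahead d u v \<Longrightarrow> rank d n u < rank d n v"
  unfolding rank_def by (intro psubset_card_mono) (auto simp: ahead_def)

text \<open>\<open>ahead d\<close> is a strict linear order, so ranks increase strictly along it and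
  are distinct; an injective self-map of a finite set is onto.\<close>

lemma rank_bij: "bij_betw (rank d n) {..<n} {..<n}"
proof -
  have "inj_on (rank d n) {..<n}"
  proof (intro inj_onI)
    fix u v assume "u \<in> {..<n}" "v \<in> {..<n}" "rank d n u = rank d n v"
    then have "\<not> ahead d u v" "\<not> ahead d v u" using rank_mono [of _ n d] by force+
    then show "u = v" by (auto simp: ahead_def)
  qed
  moreover from this have "rank d n ` {..<n} = {..<n}"
    by (intro endo_inj_surj) (use rank_less in auto)
  ultimately show ?thesis unfolding bij_betw_def by blast
qed

definition top_set :: "(nat \<Rightarrow> nat) \<Rightarrow> nat \<Rightarrow> nat \<Rightarrow> nat set" where
  "top_set d n N = {v. v < n \<and> rank d n v < N}"

lemma card_top_set: "card (top_set d n N) = min n N"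
proof -
  have "bij_betw (rank d n) (top_set d n N) {..<min n N}"
    unfolding top_set_def bij_betw_def
  proof
    show "inj_on (rank d n) {v. v < n \<and> rank d n v < N}"
      using bij_betw_imp_inj_on [OF rank_bij] by (rule inj_on_subset) auto
    have "rank d n ` {v. v < n \<and> rank d n v < N} = rank d n ` {..<n} \<inter> {..<N}"
      by auto
    then show "rank d n ` {v. v < n \<and> rank d n v < N} = {..<min n N}"
      unfolding bij_betw_imp_surj_on [OF rank_bij] by auto
  qed
  then have "card (top_set d n N) = card {..<min n N}" by (rule bij_betw_same_card)
  then show ?thesis by simp
qed

lemma top_set_all: "n \<le> N \<Longrightarrow> top_set d n N = {..<n}"
  unfolding top_set_def using less_le_trans [OF rank_less] by blast

lemma top_set_degree:
  assumes "x \<in> top_set d n N" "y < n" "y \<notin> top_set d n N"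
  shows "d y \<le> d x"
proof -
  have "rank d n x < rank d n y" using assms by (auto simp: top_set_def)
  then have "\<not> ahead d y x" using rank_mono assms(2) by (meson not_less_iff_gr_or_eq)
  then show ?thesis by (auto simp: ahead_def)
qed

section \<open>Reasoning about programs\<close>

primrec nwrites :: "com \<Rightarrow> vname set" where
  "nwrites Skip = {}"
| "nwrites (NAssign x a) = {x}"
| "nwrites (NWrite A a b) = {}"
| "nwrites (RAssign x r) = {}"
| "nwrites (Seq c1 c2) = nwrites c1 \<union> nwrites c2"
| "nwrites (Cond b c1 c2) = nwrites c1 \<union> nwrites c2"
| "nwrites (While b c) = nwrites c"

primrec awrites :: "com \<Rightarrow> vname set" where
  "awrites Skip = {}"
| "awrites (NAssign x a) = {}"
| "awrites (NWrite A a b) = {A}"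
| "awrites (RAssign x r) = {}"
| "awrites (Seq c1 c2) = awrites c1 \<union> awrites c2"
| "awrites (Cond b c1 c2) = awrites c1 \<union> awrites c2"
| "awrites (While b c) = awrites c"

primrec rwrites :: "com \<Rightarrow> vname set" where
  "rwrites Skip = {}"
| "rwrites (NAssign x a) = {}"
| "rwrites (NWrite A a b) = {}"
| "rwrites (RAssign x r) = {x}"
| "rwrites (Seq c1 c2) = rwrites c1 \<union> rwrites c2"
| "rwrites (Cond b c1 c2) = rwrites c1 \<union> rwrites c2"
| "rwrites (While b c) = rwrites c"

text \<open>Every execution relates its end points in this way (\<open>exec_frame\<close>), so loop
  invariants need mention only what the loop body changes.\<close>

definition frame :: "com \<Rightarrow> state \<Rightarrow> state \<Rightarrow> bool" where
  "frame c s s' \<longleftrightarrow>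
     (\<forall>x. x \<notin> nwrites c \<longrightarrow> nvars s' x = nvars s x) \<and>
     (\<forall>A. A \<notin> awrites c \<longrightarrow> arrs s' A = arrs s A) \<and>
     (\<forall>x. x \<notin> rwrites c \<longrightarrow> rvars s' x = rvars s x)"

lemma frame_refl: "frame c s s"
  by (simp add: frame_def)

lemma frame_trans: "frame c s s' \<Longrightarrow> frame c s' s'' \<Longrightarrow> frame c s s''"
  by (simp add: frame_def)

lemma frame_mono:
  "frame c s s' \<Longrightarrow> nwrites c \<subseteq> nwrites d \<Longrightarrow> awrites c \<subseteq> awrites d \<Longrightarrow> rwrites c \<subseteq> rwrites d
    \<Longrightarrow> frame d s s'"
  unfolding frame_def by blast

lemma exec_frame: "exec E c s t s' \<Longrightarrow> frame c s s'"
  by (induction rule: exec.induct) (simp_all add: frame_def)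

text \<open>Total correctness with an upper bound on the steps. As \<open>exec\<close> is
  deterministic, the existential describes the only execution. Sequencing becomes nesting in the
  postcondition.\<close>

definition runs ::
  "nat set set \<Rightarrow> com \<Rightarrow> state \<Rightarrow> nat \<Rightarrow> (state \<Rightarrow> bool) \<Rightarrow> bool" where
  "runs E c s T Q \<longleftrightarrow> (\<exists>t s'. exec E c s t s' \<and> t \<le> T \<and> Q s')"

text \<open>Having \<open>frame\<close> available for the new postcondition is what carries facts
  about untouched variables across a statement.\<close>

lemma runs_conseq:
  assumes "runs E c s T Q" "T \<le> T'" "\<And>s'. frame c s s' \<Longrightarrow> Q s' \<Longrightarrow> Q' s'"
  shows "runs E c s T' Q'"
  using assms exec_frame unfolding runs_def by (meson le_trans)

lemma runs_Skip: "1 \<le> T \<Longrightarrow> Q s \<Longrightarrow> runs E Skip s T Q"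
  using exec.Skip unfolding runs_def by blast

lemma runs_NAssign:
  "1 \<le> T \<Longrightarrow> Q (s\<lparr>nvars := (nvars s)(x := nval a s)\<rparr>) \<Longrightarrow> runs E (NAssign x a) s T Q"
  using exec.NAssign unfolding runs_def by blast

lemma runs_NWrite:
  "1 \<le> T \<Longrightarrow> Q (s\<lparr>arrs := (arrs s)(A := (arrs s A)(nval a s := nval b s))\<rparr>)
    \<Longrightarrow> runs E (NWrite A a b) s T Q"
  using exec.NWrite unfolding runs_def by blast

lemma runs_RAssign:
  "1 \<le> T \<Longrightarrow> Q (s\<lparr>rvars := (rvars s)(x := rval r s)\<rparr>) \<Longrightarrow> runs E (RAssign x r) s T Q"
  using exec.RAssign unfolding runs_def by blast

lemma runs_Seq:
  assumes "runs E c1 s T1 (\<lambda>s'. runs E c2 s' T2 Q)" "T1 + T2 \<le> T"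
  shows "runs E (Seq c1 c2) s T Q"
proof -
  obtain t1 s1 t2 s2 where "exec E c1 s t1 s1" "t1 \<le> T1" "exec E c2 s1 t2 s2" "t2 \<le> T2" "Q s2"
    using assms(1) unfolding runs_def by blast
  moreover from this have "exec E (Seq c1 c2) s (t1 + t2) s2" by (intro exec.Seq)
  moreover have "t1 + t2 \<le> T" using calculation assms(2) by linarith
  ultimately show ?thesis unfolding runs_def by blast
qed

lemma runs_Cond:
  assumes "bval E b s \<Longrightarrow> runs E c1 s T' Q" "\<not> bval E b s \<Longrightarrow> runs E c2 s T' Q" "1 + T' \<le> T"
  shows "runs E (Cond b c1 c2) s T Q"
proof (cases "bval E b s")
  case True
  then obtain t s' where "exec E c1 s t s'" "t \<le> T'" "Q s'"
    using assms(1) unfolding runs_def by blast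
  moreover from this have "exec E (Cond b c1 c2) s (1 + t) s'" using True by (intro exec.CondTrue)
  moreover have "1 + t \<le> T" using calculation assms(3) by linarith
  ultimately show ?thesis unfolding runs_def by blast
next
  case False
  then obtain t s' where "exec E c2 s t s'" "t \<le> T'" "Q s'"
    using assms(2) unfolding runs_def by blast
  moreover from this have "exec E (Cond b c1 c2) s (1 + t) s'" using False by (intro exec.CondFalse)
  moreover have "1 + t \<le> T" using calculation assms(3) by linarith
  ultimately show ?thesis unfolding runs_def by blast
qed

text \<open>The measure bounds the number of remaining rounds. Each round costs its guard and at
  most \<open>T\<close> steps; the guard that finally fails costs the additional 1.\<close>

lemma runs_While:
  fixes \<mu> :: "state \<Rightarrow> nat"
  assumes "I s" "\<mu> s \<le> m"
    and step: "\<And>s'. frame c s s' \<Longrightarrow> I s' \<Longrightarrow> bval E b s' \<Longrightarrow>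
      runs E c s' T (\<lambda>s''. I s'' \<and> \<mu> s'' < \<mu> s')"
    and fin: "\<And>s'. frame c s s' \<Longrightarrow> I s' \<Longrightarrow> \<not> bval E b s' \<Longrightarrow> Q s'"
  shows "runs E (While b c) s (1 + m * (T + 1)) Q"
proof -
  have "runs E (While b c) s' (1 + m * (T + 1)) Q" if "frame c s s'" "I s'" "\<mu> s' \<le> m" for s' m
    using that
  proof (induction m arbitrary: s' rule: less_induct)
    case (less m)
    show ?case
    proof (cases "bval E b s'")
      case False
      then show ?thesis
        using fin less exec.WhileFalse unfolding runs_def by (meson le_add1)
    next
      case True
      then obtain t1 s1 where 1: "exec E c s' t1 s1" "t1 \<le> T" "I s1" "\<mu> s1 < \<mu> s'"
        using step less.prems unfolding runs_def by blast
      then have m: "\<mu> s1 \<le> m - 1" "m - 1 < m" using less.prems by auto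
      have "frame c s s1" using frame_trans exec_frame 1 less.prems by blast
      then obtain t2 s2 where 2: "exec E (While b c) s1 t2 s2" "t2 \<le> 1 + (m - 1) * (T + 1)" "Q s2"
        using less.IH [OF m(2) _ 1(3) m(1)] unfolding runs_def by blast
      have "exec E (While b c) s' (1 + t1 + t2) s2"
        using True 1 2 by (intro exec.WhileTrue)
      moreover have "1 + t1 + t2 \<le> 1 + m * (T + 1)"
        using 1(2) 2(2) m by (cases m) auto
      ultimately show ?thesis using 2 unfolding runs_def by blast
    qed
  qed
  then show ?thesis using assms(1,2) frame_refl by blast
qed

definition For :: "vname \<Rightarrow> nexp \<Rightarrow> com \<Rightarrow> com" where
  "For x e c = Seq (NAssign x (NConst 0))
     (While (NLess (NVar x) e) (Seq c (NAssign x (NAdd (NVar x) (NConst 1)))))"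

lemma writes_For [simp]:
  "nwrites (For x e c) = insert x (nwrites c)"
  "awrites (For x e c) = awrites c"
  "rwrites (For x e c) = rwrites c"
  by (auto simp: For_def)

text \<open>The loop limit \<open>e\<close> is evaluated afresh in every round, hence the premise
  \<open>bound\<close>. The body must establish the next invariant for the state in which the
  counter is already increased. Guard and increment add 2 to every round; initialisation and the
  last guard give the other 2.\<close>

lemma runs_For:
  assumes x: "x \<notin> nwrites c"
    and init: "I 0 (s\<lparr>nvars := (nvars s)(x := 0)\<rparr>)"
    and bound: "\<And>i s'. frame (For x e c) s s' \<Longrightarrow> I i s' \<Longrightarrow> nval e s' = m"
    and step: "\<And>i s'. i < m \<Longrightarrow> frame (For x e c) s s' \<Longrightarrow> nvars s' x = i \<Longrightarrow> I i s' \<Longrightarrow>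
      runs E c s' T (\<lambda>s''. I (Suc i) (s''\<lparr>nvars := (nvars s'')(x := Suc i)\<rparr>))"
    and fin: "\<And>s'. frame (For x e c) s s' \<Longrightarrow> nvars s' x = m \<Longrightarrow> I m s' \<Longrightarrow> Q s'"
    and T: "2 + m * (T + 2) \<le> T'"
  shows "runs E (For x e c) s T' Q"
proof -
  let ?b = "Seq c (NAssign x (NAdd (NVar x) (NConst 1)))"
  let ?w = "While (NLess (NVar x) e) ?b"
  let ?J = "\<lambda>s'. I (nvars s' x) s' \<and> frame (For x e c) s s' \<and> nvars s' x \<le> m"
  let ?s = "s\<lparr>nvars := (nvars s)(x := 0)\<rparr>"
  have bF: "frame (For x e c) s'' s'" if "frame c s'' s'" for s'' s'
    by (rule frame_mono [OF that]) auto
  have "runs E ?w ?s (1 + m * ((T + 1) + 1)) Q"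
  proof (rule runs_While [where \<mu> = "\<lambda>s'. m - nvars s' x" and I = ?J])
    show "?J ?s" using init by (simp add: frame_def)
    show "m - nvars ?s x \<le> m" by simp
  next
    fix s' assume J: "?J s'" and "bval E (NLess (NVar x) e) s'"
    then have lt: "nvars s' x < m" using bound by auto
    show "runs E ?b s' (T + 1) (\<lambda>s''. ?J s'' \<and> m - nvars s'' x < m - nvars s' x)"
    proof (rule runs_Seq)
      show "runs E c s' T (\<lambda>s''. runs E (NAssign x (NAdd (NVar x) (NConst 1))) s'' 1
        (\<lambda>s''. ?J s'' \<and> m - nvars s'' x < m - nvars s' x))"
      proof (rule runs_conseq)
        show "runs E c s' T (\<lambda>s''. I (Suc (nvars s' x))
            (s''\<lparr>nvars := (nvars s'')(x := Suc (nvars s' x))\<rparr>))"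
          using step [OF lt _ refl] J by blast
        fix s'' assume fr: "frame c s' s''"
          and I: "I (Suc (nvars s' x)) (s''\<lparr>nvars := (nvars s'')(x := Suc (nvars s' x))\<rparr>)"
        have eq: "nvars s'' x = nvars s' x" using fr x by (simp add: frame_def)
        have "frame (For x e c) s s''" using J bF [OF fr] frame_trans by blast
        then have "frame (For x e c) s (s''\<lparr>nvars := (nvars s'')(x := Suc (nvars s' x))\<rparr>)"
          by (simp add: frame_def)
        then show "runs E (NAssign x (NAdd (NVar x) (NConst 1))) s'' 1
          (\<lambda>s''. ?J s'' \<and> m - nvars s'' x < m - nvars s' x)"
          using I lt by (intro runs_NAssign) (simp_all add: eq)
      qed simp
    qed simp
  next
    fix s' assume J: "?J s'" and "\<not> bval E (NLess (NVar x) e) s'"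
    then have "nvars s' x = m" using bound by fastforce
    then show "Q s'" using fin J by auto
  qed
  then show ?thesis
    unfolding For_def by (intro runs_Seq [OF runs_NAssign]) (use T in auto)
qed

section \<open>Evaluating a candidate\<close>

abbreviation var :: "vname \<Rightarrow> nexp" where "var \<equiv> NVar"
abbreviation num :: "nat \<Rightarrow> nexp" where "num \<equiv> NConst"
abbreviation cell :: "vname \<Rightarrow> vname \<Rightarrow> nexp" where "cell A x \<equiv> NRead A (NVar x)"

text \<open>
  The double loop sees every edge inside the set twice, and the machine cannot halve a real, so \<open>z\<close>
  and \<open>best\<close> hold twice the coverage.
\<close>

definition eval_cov :: com where
  "eval_cov = Seq (RAssign ''z'' (ROfNat (num 0)))
    (For ''i'' (var ''n'') (For ''j'' (var ''n'')
      (Cond (BAnd (Adj (var ''i'') (var ''j'')) (NLess (num 0) (cell ''X'' ''i'')))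
        (Cond (NLess (num 0) (cell ''X'' ''j''))
          (RAssign ''z'' (RAdd (RVar ''z'') (RSub (ROfNat (num 1)) (RVar ''alpha''))))
          (RAssign ''z'' (RAdd (RVar ''z'') (RAdd (RVar ''alpha'') (RVar ''alpha'')))))
        Skip)))"

definition copy_array :: "vname \<Rightarrow> vname \<Rightarrow> com" where
  "copy_array A B = For ''i'' (var ''n'') (NWrite A (var ''i'') (cell B ''i''))"

text \<open>Only strict improvements are accepted, which makes the local search terminate;
  \<open>flag\<close> tells it whether one occurred.\<close>

definition try_X :: com where
  "try_X = Seq eval_cov
    (Cond (RLess (RVar ''best'') (RVar ''z''))
      (Seq (copy_array ''S'' ''X'') (Seq (RAssign ''best'' (RVar ''z'')) (NAssign ''flag'' (num 1))))
      Skip)"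

lemma writes_eval_cov [simp]:
  "nwrites eval_cov = {''i'', ''j''}" "awrites eval_cov = {}" "rwrites eval_cov = {''z''}"
  by (auto simp: eval_cov_def)

lemma writes_copy_array [simp]:
  "nwrites (copy_array A B) = {''i''}" "awrites (copy_array A B) = {A}" "rwrites (copy_array A B) = {}"
  by (auto simp: copy_array_def)

lemma writes_try_X [simp]:
  "nwrites try_X = {''i'', ''j'', ''flag''}" "awrites try_X = {''S''}"
  "rwrites try_X = {''z'', ''best''}"
  by (auto simp: try_X_def)

text \<open>In contrast to \<open>output_set\<close>, cells from \<open>n\<close> on are ignored, so
  a candidate array may hold anything there.\<close>

definition supp :: "nat \<Rightarrow> (nat \<Rightarrow> nat) \<Rightarrow> nat set" where
  "supp n A = {v. v < n \<and> A v \<noteq> 0}"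

lemma supp_subset [simp]: "supp n A \<subseteq> {..<n}"
  by (auto simp: supp_def)

lemma runs_copy_array:
  assumes "nvars s ''n'' = n" "A \<noteq> B" "2 + n * (1 + 2) \<le> T"
  shows "runs E (copy_array A B) s T
    (\<lambda>s'. \<forall>v. arrs s' A v = (if v < n then arrs s B v else arrs s A v))"
  unfolding copy_array_def
  by (rule runs_For [where m = n and T = 1 and
        I = "\<lambda>i s'. \<forall>v. arrs s' A v = (if v < i then arrs s B v else arrs s A v)"])
     (use assms in \<open>auto simp: frame_def less_Suc_eq intro!: runs_NWrite\<close>)

text \<open>This and the later time bounds keep the shape in which the rules for \<open>runs\<close>
  produce them, so that the rules apply without arithmetic.\<close>

definition eval_time :: "nat \<Rightarrow> nat" where
  "eval_time n = 1 + (2 + n * ((2 + n * (3 + 2)) + 2))"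

definition try_time :: "nat \<Rightarrow> nat" where
  "try_time n = eval_time n + (1 + ((2 + n * 3) + (1 + 1)))"

locale fcgp_input = fcgp "{..<n}" E \<alpha> for n :: nat and E :: "nat set set" and \<alpha> :: real +
  fixes k :: nat and \<epsilon> :: real
  assumes k_le: "k \<le> n" and eps: "0 < \<epsilon>" "\<epsilon> < 1"
begin

definition params :: "state \<Rightarrow> bool" where
  "params s \<longleftrightarrow> nvars s ''n'' = n \<and> nvars s ''k'' = k \<and> rvars s ''alpha'' = \<alpha> \<and> rvars s ''eps'' = \<epsilon>"

lemma params_frame:
  assumes "params s" "frame c s s'" "{''n'', ''k''} \<inter> nwrites c = {}"
    "{''alpha'', ''eps''} \<inter> rwrites c = {}"
  shows "params s'"
  using assms by (auto simp: params_def frame_def)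

text \<open>The summand \<open>g i j\<close> is the contribution of one iteration. An edge inside
  the set is met in both orders with weight \<open>1 - \<alpha>\<close>, a cut edge only from its
  endpoint in the set, with weight \<open>2 * \<alpha>\<close>. By \<open>cov_arcs\<close> the total
  is twice the coverage.\<close>

lemma runs_eval_cov:
  assumes s: "params s" and T: "eval_time n \<le> T"
  shows "runs E eval_cov s T (\<lambda>s'. rvars s' ''z'' = 2 * f (supp n (arrs s ''X'')))"
proof -
  define X where "X = arrs s ''X''"
  define g where "g i j = (if {i, j} \<in> E \<and> X i \<noteq> 0 then if X j \<noteq> 0 then 1 - \<alpha> else 2 * \<alpha> else 0)" for i j
  let ?U = "supp n X"
  have g: "g i j = (if i \<in> ?U then (if j \<in> ?U then 1 - \<alpha> else 2 * \<alpha>) * adj E i j else 0)"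
    if "i < n" "j < n" for i j
    using that by (auto simp: g_def supp_def adj_def)
  have row: "(\<Sum>j<n. g i j) = (1 - \<alpha>) * arcs E {i} ?U + 2 * \<alpha> * arcs E {i} ({..<n} - ?U)"
    if "i \<in> ?U" for i
  proof -
    have "(\<Sum>j<n. g i j) = (\<Sum>j\<in>?U. g i j) + (\<Sum>j\<in>{..<n} - ?U. g i j)"
      by (subst sum.subset_diff [of ?U]) auto
    also have "(\<Sum>j\<in>?U. g i j) = (\<Sum>j\<in>?U. (1 - \<alpha>) * adj E i j)"
      using that by (intro sum.cong) (auto simp: g supp_def)
    also have "(\<Sum>j\<in>{..<n} - ?U. g i j) = (\<Sum>j\<in>{..<n} - ?U. 2 * \<alpha> * adj E i j)"
      using that by (intro sum.cong) (auto simp: g supp_def)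
    finally show ?thesis by (simp add: arcs_def sum_distrib_left)
  qed
  have "(\<Sum>i<n. \<Sum>j<n. g i j) = (\<Sum>i\<in>?U. \<Sum>j<n. g i j)"
    by (rule sum.mono_neutral_right) (auto simp: g)
  also have "\<dots> = (1 - \<alpha>) * arcs E ?U ?U + 2 * \<alpha> * arcs E ?U ({..<n} - ?U)"
    by (simp add: row sum.distrib sum_arcs_left flip: sum_distrib_left)
  finally have total: "(\<Sum>i<n. \<Sum>j<n. g i j) = 2 * f ?U"
    by (simp add: cov_arcs)
  show ?thesis
    unfolding eval_cov_def
  proof (rule runs_Seq [OF runs_RAssign])
    let ?s = "s\<lparr>rvars := (rvars s)(''z'' := rval (ROfNat (num 0)) s)\<rparr>"
    let ?I = "\<lambda>i s'. rvars s' ''z'' = (\<Sum>i<i. \<Sum>j<n. g i j)"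
    let ?J = "\<lambda>i j s'. rvars s' ''z'' = (\<Sum>i<i. \<Sum>j<n. g i j) + (\<Sum>j<j. g i j)"
    let ?body = "Cond (BAnd (Adj (var ''i'') (var ''j'')) (NLess (num 0) (cell ''X'' ''i'')))
        (Cond (NLess (num 0) (cell ''X'' ''j''))
          (RAssign ''z'' (RAdd (RVar ''z'') (RSub (ROfNat (num 1)) (RVar ''alpha''))))
          (RAssign ''z'' (RAdd (RVar ''z'') (RAdd (RVar ''alpha'') (RVar ''alpha'')))))
        Skip"
    show "runs E (For ''i'' (var ''n'') (For ''j'' (var ''n'') ?body)) ?s
      (2 + n * ((2 + n * (3 + 2)) + 2)) (\<lambda>s'. rvars s' ''z'' = 2 * f (supp n (arrs s ''X'')))"
    proof (rule runs_For [where I = ?I and m = n])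
      fix i s1
      assume i: "i < n" and fr1: "frame (For ''i'' (var ''n'') (For ''j'' (var ''n'') ?body)) ?s s1"
        and vi: "nvars s1 ''i'' = i" and I: "?I i s1"
      have s1: "nvars s1 ''n'' = n" "rvars s1 ''alpha'' = \<alpha>" "arrs s1 ''X'' = X"
        using fr1 s by (auto simp: frame_def params_def X_def)
      show "runs E (For ''j'' (var ''n'') ?body) s1 (2 + n * (3 + 2))
        (\<lambda>s'. ?I (Suc i) (s'\<lparr>nvars := (nvars s')(''i'' := Suc i)\<rparr>))"
      proof (rule runs_For [where I = "?J i" and m = n])
        fix j s2
        assume j: "j < n" and fr2: "frame (For ''j'' (var ''n'') ?body) s1 s2"
          and vj: "nvars s2 ''j'' = j" and J: "?J i j s2"
        have s2: "nvars s2 ''i'' = i" "rvars s2 ''alpha'' = \<alpha>" "arrs s2 ''X'' = X"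
          using fr2 s1 vi by (auto simp: frame_def)
        show "runs E ?body s2 3 (\<lambda>s'. ?J i (Suc j) (s'\<lparr>nvars := (nvars s')(''j'' := Suc j)\<rparr>))"
          by (rule runs_Cond [where T' = 2])
             (auto intro!: runs_Cond [where T' = 1] runs_RAssign runs_Skip simp: s2 vj J g_def)
      qed (use I s1 in \<open>auto simp: frame_def\<close>)
    qed (use s total in \<open>auto simp: frame_def params_def X_def\<close>)
  qed (use T in \<open>auto simp: eval_time_def\<close>)
qed

lemma runs_try_X:
  assumes s: "params s" and sub: "output_set s \<subseteq> {..<n}" and T: "try_time n \<le> T"
  defines "U \<equiv> supp n (arrs s ''X'')"
  shows "runs E try_X s T (\<lambda>s'.
    if rvars s ''best'' < 2 * f U
    then output_set s' = U \<and> rvars s' ''best'' = 2 * f U \<and> nvars s' ''flag'' = 1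
    else output_set s' = output_set s \<and> rvars s' ''best'' = rvars s ''best''
      \<and> nvars s' ''flag'' = nvars s ''flag'')"
    (is "runs E _ _ _ ?Q")
  unfolding try_X_def
proof (rule runs_Seq)
  let ?upd = "Seq (RAssign ''best'' (RVar ''z'')) (NAssign ''flag'' (num 1))"
  let ?c = "Cond (RLess (RVar ''best'') (RVar ''z'')) (Seq (copy_array ''S'' ''X'') ?upd) Skip"
  show "runs E eval_cov s (eval_time n) (\<lambda>s'. runs E ?c s' (1 + ((2 + n * 3) + (1 + 1))) ?Q)"
  proof (rule runs_conseq [OF runs_eval_cov [OF s order_refl] order_refl])
    fix s1 assume fr: "frame eval_cov s s1" and z: "rvars s1 ''z'' = 2 * f (supp n (arrs s ''X''))"
    have s1: "nvars s1 ''n'' = n" "arrs s1 = arrs s" "rvars s1 ''best'' = rvars s ''best''"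
      "nvars s1 ''flag'' = nvars s ''flag''" "output_set s1 = output_set s"
      using fr s by (auto simp: frame_def params_def output_set_def)
    show "runs E ?c s1 (1 + ((2 + n * 3) + (1 + 1))) ?Q"
    proof (rule runs_Cond [OF _ _ order_refl])
      assume b: "bval E (RLess (RVar ''best'') (RVar ''z'')) s1"
      show "runs E (Seq (copy_array ''S'' ''X'') ?upd) s1 ((2 + n * 3) + (1 + 1)) ?Q"
      proof (rule runs_Seq [OF _ order_refl])
        show "runs E (copy_array ''S'' ''X'') s1 (2 + n * 3) (\<lambda>s'. runs E ?upd s' (1 + 1) ?Q)"
        proof (rule runs_conseq [OF runs_copy_array [OF s1(1)] order_refl])
          fix s2 assume fr2: "frame (copy_array ''S'' ''X'') s1 s2"
            and S: "\<forall>v. arrs s2 ''S'' v = (if v < n then arrs s1 ''X'' v else arrs s1 ''S'' v)"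
          \<comment> \<open>\<open>copy_array\<close> leaves the cells from \<open>n\<close> on
            alone; they are zero because \<open>output_set s\<close> lies below
            \<open>n\<close>.\<close>
          have "output_set s2 = U"
            using S s1 sub by (force simp: output_set_def U_def supp_def)
          then show "runs E ?upd s2 (1 + 1) ?Q"
            using b fr2 s1 z
            by (intro runs_Seq [OF runs_RAssign order_refl] runs_NAssign)
               (auto simp: frame_def output_set_def U_def)
        qed auto
      qed
    next
      assume "\<not> bval E (RLess (RVar ''best'') (RVar ''z'')) s1"
      then show "runs E Skip s1 ((2 + n * 3) + (1 + 1)) ?Q"
        using s1 z by (intro runs_Skip) (auto simp: U_def)
    qed
  qed
qed (use T in \<open>simp add: try_time_def\<close>)

end

section \<open>Local search\<close>

text \<open>The initial value \<open>-1\<close> of \<open>best\<close> makes \<open>try_X\<close> accept the first candidate.\<close>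

definition init_prog :: com where
  "init_prog = Seq (For ''i'' (var ''k'') (NWrite ''X'' (var ''i'') (num 1)))
    (Seq (RAssign ''best'' (RSub (ROfNat (num 0)) (ROfNat (num 1)))) try_X)"

definition swap_prog :: com where
  "swap_prog = Cond (BAnd (NLess (num 0) (cell ''S'' ''a'')) (BNot (NLess (num 0) (cell ''S'' ''b''))))
    (Seq (copy_array ''X'' ''S'')
      (Seq (NWrite ''X'' (var ''a'') (num 0)) (Seq (NWrite ''X'' (var ''b'') (num 1)) try_X)))
    Skip"

text \<open>After a successful swap the sweep goes on with the new set, so only a sweep without any
  success, during which the set stays fixed, certifies that no swap improves it.\<close>

definition round_prog :: com where
  "round_prog = Seq (NAssign ''flag'' (num 0))
     (For ''a'' (var ''n'') (For ''b'' (var ''n'') swap_prog))"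

definition local_prog :: com where
  "local_prog = Seq init_prog (While (NLess (num 0) (var ''flag'')) round_prog)"

lemma writes_swap_prog [simp]:
  "nwrites swap_prog = {''i'', ''j'', ''flag''}" "awrites swap_prog = {''X'', ''S''}"
  "rwrites swap_prog = {''z'', ''best''}"
  by (auto simp: swap_prog_def)

lemma writes_round_prog [simp]:
  "nwrites round_prog = {''i'', ''j'', ''flag'', ''a'', ''b''}" "awrites round_prog = {''X'', ''S''}"
  "rwrites round_prog = {''z'', ''best''}"
  by (auto simp: round_prog_def)

definition swap_time :: "nat \<Rightarrow> nat" where
  "swap_time n = 1 + ((2 + n * 3) + (1 + (1 + try_time n)))"

definition round_time :: "nat \<Rightarrow> nat" where
  "round_time n = 1 + (2 + n * ((2 + n * (swap_time n + 2)) + 2))"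

text \<open>The factor \<open>Suc (Suc (n * n) * Suc (n * n))\<close> allows one round for each
  attainable value and a last one without improvement.\<close>

definition local_time :: "nat \<Rightarrow> nat" where
  "local_time n = (2 + n * 3) + (1 + try_time n) + (1 + Suc (Suc (n * n) * Suc (n * n)) * (round_time n + 1))"

context fcgp_input
begin

text \<open>The invariant from the end of \<open>init_prog\<close> on: the output array always holds
  a feasible set whose doubled coverage is cached in \<open>best\<close>.\<close>

definition good :: "state \<Rightarrow> bool" where
  "good s \<longleftrightarrow> params s \<and> output_set s \<subseteq> {..<n} \<and> card (output_set s) = k \<and>
    rvars s ''best'' = 2 * f (output_set s)"

lemma output_set_upd [simp]:
  "output_set (s\<lparr>nvars := g\<rparr>) = output_set s" "output_set (s\<lparr>rvars := h\<rparr>) = output_set s"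
  by (simp_all add: output_set_def)

lemma good_nvars [simp]:
  "g ''n'' = nvars s ''n'' \<Longrightarrow> g ''k'' = nvars s ''k'' \<Longrightarrow> good (s\<lparr>nvars := g\<rparr>) = good s"
  by (simp add: good_def params_def)

lemma good_frame:
  assumes "good s" "frame c s s'" "{''n'', ''k''} \<inter> nwrites c = {}" "''S'' \<notin> awrites c"
    "{''alpha'', ''eps'', ''best''} \<inter> rwrites c = {}"
  shows "good s'"
  using assms by (auto simp: good_def params_def frame_def output_set_def)

lemma runs_try_good:
  assumes s: "good s" and U: "supp n (arrs s ''X'') = U" "card U = k" and T: "try_time n \<le> T"
  shows "runs E try_X s T (\<lambda>s'. good s' \<and>
    (if rvars s ''best'' < 2 * f U
     then rvars s' ''best'' = 2 * f U \<and> nvars s' ''flag'' = 1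
     else output_set s' = output_set s \<and> rvars s' ''best'' = rvars s ''best''
       \<and> nvars s' ''flag'' = nvars s ''flag''))"
proof -
  have p: "params s" "output_set s \<subseteq> {..<n}" using s by (auto simp: good_def)
  show ?thesis
  proof (rule runs_conseq [OF runs_try_X [OF p order_refl] T], goal_cases)
    case (1 s')
    have "params s'" using 1(1) by (rule params_frame [OF p(1)]) auto
    moreover have "U \<subseteq> {..<n}" unfolding U(1) [symmetric] by simp
    ultimately show ?case using 1(2) s U by (auto simp: good_def split: if_splits)
  qed
qed

lemma runs_swap_prog:
  assumes s: "good s" and ab: "nvars s ''a'' = a" "nvars s ''b'' = b" "a < n" "b < n"
    and T: "swap_time n \<le> T"
  defines "S \<equiv> output_set s"
  shows "runs E swap_prog s T (\<lambda>s'. good s' \<and>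
    (nvars s' ''flag'' = 1 \<and> rvars s ''best'' < rvars s' ''best'' \<or>
     nvars s' ''flag'' = nvars s ''flag'' \<and> output_set s' = S \<and>
      (a \<in> S \<longrightarrow> b \<notin> S \<longrightarrow> f (insert b (S - {a})) \<le> f S)))"
    (is "runs E _ _ _ ?Q")
  unfolding swap_prog_def
proof (rule runs_Cond)
  let ?w = "Seq (NWrite ''X'' (var ''a'') (num 0)) (Seq (NWrite ''X'' (var ''b'') (num 1)) try_X)"
  assume "bval E (BAnd (NLess (num 0) (cell ''S'' ''a'')) (BNot (NLess (num 0) (cell ''S'' ''b'')))) s"
  then have S: "a \<in> S" "b \<notin> S" by (auto simp: ab S_def output_set_def)
  have Sn: "S \<subseteq> {..<n}" "card S = k" "rvars s ''best'' = 2 * f S" "nvars s ''n'' = n"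
    using s by (auto simp: good_def S_def params_def)
  show "runs E (Seq (copy_array ''X'' ''S'') ?w) s ((2 + n * 3) + (1 + (1 + try_time n))) ?Q"
  proof (rule runs_Seq [OF _ order_refl])
    show "runs E (copy_array ''X'' ''S'') s (2 + n * 3)
      (\<lambda>s'. runs E ?w s' (1 + (1 + try_time n)) ?Q)"
    proof (rule runs_conseq [OF runs_copy_array [OF Sn(4)] order_refl])
      fix s1 assume fr: "frame (copy_array ''X'' ''S'') s s1"
        and X: "\<forall>v. arrs s1 ''X'' v = (if v < n then arrs s ''S'' v else arrs s ''X'' v)"
      have s1: "nvars s1 ''a'' = a" "nvars s1 ''b'' = b" "nvars s1 ''flag'' = nvars s ''flag''"
        "output_set s1 = S" "rvars s1 ''best'' = 2 * f S"
        using fr ab Sn by (auto simp: frame_def output_set_def S_def)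
      define X' where "X' = (arrs s1 ''X'')(a := 0, b := 1)"
      define s2 where "s2 = s1\<lparr>arrs := (arrs s1)(''X'' := X')\<rparr>"
      have "frame (copy_array ''X'' ''S'') s s2"
        using fr by (auto simp: frame_def s2_def)
      then have g2: "good s2" by (rule good_frame [OF s]) auto
      have U: "supp n (arrs s2 ''X'') = insert b (S - {a})"
        using X ab Sn S by (auto simp: supp_def s2_def X'_def S_def output_set_def)
      have "finite S" using Sn finite_sub by blast
      then have cU: "card (insert b (S - {a})) = k"
        using S Sn card_gt_0_iff [of S] by auto
      have "runs E try_X s2 (try_time n) ?Q"
        using Sn(3) s1
        by (intro runs_conseq [OF runs_try_good [OF g2 U cU order_refl]])
           (auto simp: s2_def output_set_def split: if_splits)
      moreover have "s2 = s1\<lparr>arrs := (arrs s1)(''X'' := (arrs s1 ''X'')(a := 0),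
          ''X'' := (arrs s1 ''X'')(a := 0, b := 1))\<rparr>"
        by (simp add: s2_def X'_def)
      ultimately show "runs E ?w s1 (1 + (1 + try_time n)) ?Q"
        by (intro runs_Seq [OF runs_NWrite order_refl]) (auto simp: s1)
    qed auto
  qed
next
  assume "\<not> bval E (BAnd (NLess (num 0) (cell ''S'' ''a'')) (BNot (NLess (num 0) (cell ''S'' ''b'')))) s"
  then show "runs E Skip s ((2 + n * 3) + (1 + (1 + try_time n))) ?Q"
    using s by (intro runs_Skip) (auto simp: ab S_def output_set_def)
qed (use T in \<open>simp add: swap_time_def\<close>)

text \<open>Invariant of the sweep: either a swap has succeeded, or the set is unchanged and none of
  the pairs tried so far improves it. The first alternative persists because \<open>best\<close>
  never decreases.\<close>

lemma runs_round_prog: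
  assumes s: "good s" and T: "round_time n \<le> T"
  shows "runs E round_prog s T (\<lambda>s'. good s' \<and>
    (nvars s' ''flag'' = 1 \<and> rvars s ''best'' < rvars s' ''best'' \<or>
     nvars s' ''flag'' = 0 \<and> swap_opt (output_set s')))"
    (is "runs E _ _ _ ?Q")
  unfolding round_prog_def
proof (rule runs_Seq [OF runs_NAssign])
  define S where "S = output_set s"
  let ?s = "s\<lparr>nvars := (nvars s)(''flag'' := nval (num 0) s)\<rparr>"
  let ?impr = "\<lambda>s'. nvars s' ''flag'' = 1 \<and> 2 * f S < rvars s' ''best''"
  let ?ok = "\<lambda>a b. a \<in> S \<longrightarrow> b \<notin> S \<longrightarrow> f (insert b (S - {a})) \<le> f S"
  let ?I = "\<lambda>a s'. good s' \<and> (?impr s' \<or>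
    nvars s' ''flag'' = 0 \<and> output_set s' = S \<and> (\<forall>a'<a. \<forall>b'<n. ?ok a' b'))"
  let ?J = "\<lambda>a b s'. good s' \<and> (?impr s' \<or>
    nvars s' ''flag'' = 0 \<and> output_set s' = S \<and> (\<forall>a'<a. \<forall>b'<n. ?ok a' b') \<and> (\<forall>b'<b. ?ok a b'))"
  have nv: "good s' \<Longrightarrow> nvars s' ''n'' = n" and bs: "good s' \<Longrightarrow> rvars s' ''best'' = 2 * f (output_set s')" for s'
    by (simp_all add: good_def params_def)
  show "runs E (For ''a'' (var ''n'') (For ''b'' (var ''n'') swap_prog)) ?s
    (2 + n * ((2 + n * (swap_time n + 2)) + 2)) ?Q"
  proof (rule runs_For [where I = ?I and m = n])
    fix a s1 assume a: "a < n" and va: "nvars s1 ''a'' = a" and I: "?I a s1"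
    show "runs E (For ''b'' (var ''n'') swap_prog) s1 (2 + n * (swap_time n + 2))
      (\<lambda>s'. ?I (Suc a) (s'\<lparr>nvars := (nvars s')(''a'' := Suc a)\<rparr>))"
    proof (rule runs_For [where I = "?J a" and m = n])
      fix b s2 assume b: "b < n" and fr: "frame (For ''b'' (var ''n'') swap_prog) s1 s2"
        and vb: "nvars s2 ''b'' = b" and J: "?J a b s2"
      have va2: "nvars s2 ''a'' = a" using fr va by (auto simp: frame_def)
      show "runs E swap_prog s2 (swap_time n)
        (\<lambda>s'. ?J a (Suc b) (s'\<lparr>nvars := (nvars s')(''b'' := Suc b)\<rparr>))"
      proof (rule runs_conseq [OF runs_swap_prog [OF conjunct1 [OF J] va2 vb a b order_refl] order_refl],
          goal_cases)
        case (1 s3)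
        have g: "good s3" "good s2" using 1(2) J by simp_all
        have "?J a (Suc b) s3"
        proof (cases "?impr s2")
          case True
          then have "?impr s3" using 1(2) bs [OF g(1)] bs [OF g(2)] by auto
          then show ?thesis using g by simp
        next
          case False
          then have J0: "nvars s2 ''flag'' = 0" "output_set s2 = S"
            "\<forall>a'<a. \<forall>b'<n. ?ok a' b'" "\<forall>b'<b. ?ok a b'"
            using J by blast+
          show ?thesis
          proof (cases "?impr s3")
            case False
            then have "nvars s3 ''flag'' = 0" "output_set s3 = S" "?ok a b"
              using 1(2) J0(1,2) bs [OF g(2)] by (metis+)
            then show ?thesis using g(1) J0(3,4) less_Suc_eq by simp
          qed (use g in simp)
        qed
        then show ?case by simp
      qed
    qed (use I in \<open>auto simp: nv less_Suc_eq\<close>)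
  next
    fix s' assume I: "?I n s'"
    have "swap_opt S" if "\<forall>a'<n. \<forall>b'<n. ?ok a' b'"
      unfolding swap_opt_def
    proof (intro ballI)
      fix a b assume "a \<in> S" "b \<in> {..<n} - S"
      moreover from this have "a < n" using s by (auto simp: good_def S_def)
      ultimately show "f (insert b (S - {a})) \<le> f S" using that by simp
    qed
    then show "?Q s'" using I bs [OF s] unfolding S_def by metis
  qed (use s in \<open>auto simp: nv S_def\<close>)
qed (use T in \<open>auto simp: round_time_def\<close>)

text \<open>
  The coverage takes at most \<open>(n\<^sup>2 + 1)\<^sup>2\<close> values, which bounds the number of improving rounds.
\<close>

definition attainable :: "real set" where
  "attainable = (\<lambda>(x, y). 2 * ((1 - \<alpha>) * real x + \<alpha> * real y)) ` ({..n * n} \<times> {..n * n})"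

lemma arcs_le:
  "X \<subseteq> {..<n} \<Longrightarrow> Y \<subseteq> {..<n} \<Longrightarrow> arcs E X Y \<le> real (n * n)"
proof -
  assume X: "X \<subseteq> {..<n}" and Y: "Y \<subseteq> {..<n}"
  have "arcs E X Y \<le> (\<Sum>x\<in>X. \<Sum>y\<in>Y. 1)"
    unfolding arcs_def by (intro sum_mono) (simp add: adj_def)
  also have "\<dots> = real (card X * card Y)" by simp
  also have "\<dots> \<le> real (n * n)"
    using X Y card_mono [of "{..<n}"] by (intro of_nat_mono mult_mono) auto
  finally show ?thesis .
qed

lemma cov_attainable:
  assumes "S \<subseteq> {..<n}"
  shows "2 * f S \<in> attainable"
proof -
  have "real (edges_within E S) \<le> real (n * n)"
    using arcs_within [of S] arcs_le [OF assms assms] assms finite_sub by simp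
  moreover have "real (edges_between E S ({..<n} - S)) \<le> real (n * n)"
    using arcs_between [OF assms] arcs_le [OF assms, of "{..<n} - S"] by auto
  ultimately have "edges_within E S \<le> n * n" "edges_between E S ({..<n} - S) \<le> n * n"
    unfolding of_nat_le_iff .
  then show ?thesis
    by (auto simp: attainable_def cov_def intro!: image_eqI [of _ _ "(edges_within E S, edges_between E S ({..<n} - S))"])
qed

lemma finite_attainable: "finite attainable"
  by (simp add: attainable_def)

lemma card_attainable: "card attainable \<le> Suc (n * n) * Suc (n * n)"
  unfolding attainable_def using card_image_le [of "{..n * n} \<times> {..n * n}"] by (auto simp: card_cartesian_product)

text \<open>The value -1 is no coverage, so \<open>good\<close> fails until the first candidate
  \<open>{..<k}\<close> has been accepted; this is why \<open>runs_try_X\<close> is used directly.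
  Acceptance also raises \<open>flag\<close>, which starts the rounds.\<close>

lemma runs_init_prog:
  "runs E init_prog (input_state n k \<alpha> \<epsilon>) ((2 + n * 3) + (1 + try_time n))
    (\<lambda>s'. good s' \<and> nvars s' ''flag'' = 1)" (is "runs E _ _ _ ?Q")
proof -
  let ?s = "input_state n k \<alpha> \<epsilon>"
  let ?r = "Seq (RAssign ''best'' (RSub (ROfNat (num 0)) (ROfNat (num 1)))) try_X"
  let ?l = "For ''i'' (var ''k'') (NWrite ''X'' (var ''i'') (num 1))"
  show ?thesis
    unfolding init_prog_def
  proof (rule runs_Seq [OF _ order_refl])
    show "runs E ?l ?s (2 + n * 3) (\<lambda>s'. runs E ?r s' (1 + try_time n) ?Q)"
    proof (rule runs_For [where m = k and T = 1 and I = "\<lambda>i s'. \<forall>v. arrs s' ''X'' v = of_bool (v < i)"])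
      fix s' assume fr: "frame ?l ?s s'" and X: "\<forall>v. arrs s' ''X'' v = of_bool (v < k)"
      define s1 where "s1 = s'\<lparr>rvars := (rvars s')(''best'' := -1)\<rparr>"
      have p: "params s1" using fr by (auto simp: params_def s1_def frame_def input_state_def)
      have o: "output_set s1 = {}" using fr by (auto simp: s1_def frame_def input_state_def output_set_def)
      have U: "supp n (arrs s1 ''X'') = {..<k}" using X k_le by (auto simp: supp_def s1_def)
      have b: "rvars s1 ''best'' < 2 * f {..<k}" using cov_nonneg [of "{..<k}"] by (simp add: s1_def)
      have "runs E try_X s1 (try_time n) ?Q"
      proof (rule runs_conseq [OF runs_try_X [OF p _ order_refl] order_refl], goal_cases)
        case (2 s2)
        have "params s2" using 2(1) by (rule params_frame [OF p]) auto
        then show ?case using 2(2) b k_le by (auto simp: good_def U)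
      qed (use o in auto)
      then show "runs E ?r s' (1 + try_time n) ?Q"
        by (intro runs_Seq [OF runs_RAssign order_refl]) (auto simp: s1_def)
    qed (use k_le in \<open>auto simp: input_state_def frame_def intro!: runs_NWrite\<close>)
  qed
qed

lemma runs_local_prog:
  "runs E local_prog (input_state n k \<alpha> \<epsilon>) (local_time n) (\<lambda>s'. good s' \<and> swap_opt (output_set s'))"
  unfolding local_prog_def
proof (rule runs_Seq)
  let ?w = "While (NLess (num 0) (var ''flag'')) round_prog"
  let ?V = "Suc (n * n) * Suc (n * n)"
  \<comment> \<open>Coverages are real, so progress is measured by the number of attainable values
    that still exceed \<open>best\<close>. An improvement removes at least the new value of
    \<open>best\<close> from this set.\<close>
  define above where "above s = {w \<in> attainable. rvars (s :: state) ''best'' < w}" for s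
  have fin: "finite (above s)" for s using finite_attainable by (simp add: above_def)
  show "runs E init_prog (input_state n k \<alpha> \<epsilon>) ((2 + n * 3) + (1 + try_time n))
    (\<lambda>s'. runs E ?w s' (1 + Suc ?V * (round_time n + 1)) (\<lambda>s'. good s' \<and> swap_opt (output_set s')))"
  proof (rule runs_conseq [OF runs_init_prog order_refl])
    fix s assume fr0: "frame init_prog (input_state n k \<alpha> \<epsilon>) s" and g: "good s \<and> nvars s ''flag'' = 1"
    show "runs E ?w s (1 + Suc ?V * (round_time n + 1)) (\<lambda>s'. good s' \<and> swap_opt (output_set s'))"
    \<comment> \<open>The \<open>Suc\<close> in the measure lets it drop also in the last round,
      which clears \<open>flag\<close> without changing \<open>best\<close>.\<close>
    proof (rule runs_While [where I = "\<lambda>s'. good s' \<and> (nvars s' ''flag'' = 0 \<longrightarrow> swap_opt (output_set s'))"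
          and \<mu> = "\<lambda>s' :: state. if nvars s' ''flag'' = 0 then 0 else Suc (card (above s'))"])
      show "good s \<and> (nvars s ''flag'' = 0 \<longrightarrow> swap_opt (output_set s))"
        using g by simp
      have "card (above s) \<le> card attainable"
        using finite_attainable by (intro card_mono) (auto simp: above_def)
      then show "(if nvars s ''flag'' = 0 then 0 else Suc (card (above s))) \<le> Suc ?V"
        using card_attainable by auto
    next
      fix s1 assume I: "good s1 \<and> (nvars s1 ''flag'' = 0 \<longrightarrow> swap_opt (output_set s1))"
        and b: "bval E (NLess (num 0) (var ''flag'')) s1"
      show "runs E round_prog s1 (round_time n) (\<lambda>s2.
         (good s2 \<and> (nvars s2 ''flag'' = 0 \<longrightarrow> swap_opt (output_set s2))) \<and>
         (if nvars s2 ''flag'' = 0 then 0 else Suc (card (above s2)))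
         < (if nvars s1 ''flag'' = 0 then 0 else Suc (card (above s1))))"
      proof (rule runs_conseq [OF runs_round_prog [OF conjunct1 [OF I] order_refl] order_refl], goal_cases)
        case (1 s2)
        have "card (above s2) < card (above s1)" if "rvars s1 ''best'' < rvars s2 ''best''"
        proof (rule psubset_card_mono [OF fin])
          have "rvars s2 ''best'' \<in> attainable" using 1(2) cov_attainable by (auto simp: good_def)
          then show "above s2 \<subset> above s1" using that by (auto simp: above_def)
        qed
        then show ?case using 1(2) b by auto
      qed
    qed auto
  qed
qed (simp add: local_time_def)

end

section \<open>Enumerating the small sets of high-degree vertices\<close>

definition degs_prog :: com where
  "degs_prog = For ''i'' (var ''n'') (Seq (NWrite ''D'' (var ''i'') (num 0))
    (For ''j'' (var ''n'') (Cond (Adj (var ''i'') (var ''j''))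
      (NWrite ''D'' (var ''i'') (NAdd (cell ''D'' ''i'') (num 1))) Skip)))"

text \<open>
  \<open>N\<close> becomes \<open>k\<close> times the least \<open>L\<close> with \<open>9 \<le> L\<epsilon>\<close>, except that \<open>L\<close> is capped at \<open>n\<close>, so that the loop
  is polynomial also when \<open>k = 0\<close>.
\<close>

definition limit_prog :: com where
  "limit_prog = Seq (NAssign ''N'' (num 0)) (Seq (RAssign ''acc'' (ROfNat (num 0)))
    (For ''i'' (var ''n'') (Cond (RLess (RVar ''acc'') (ROfNat (num 9)))
      (Seq (RAssign ''acc'' (RAdd (RVar ''acc'') (RVar ''eps'')))
        (NAssign ''N'' (NAdd (var ''N'') (var ''k'')))) Skip)))"

definition rank_prog :: com where
  "rank_prog = Seq (NAssign ''r'' (num 0)) (For ''i'' (var ''n'')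
    (Cond (BNot (BAnd (BNot (NLess (cell ''D'' ''v'') (cell ''D'' ''i'')))
        (BNot (BAnd (BNot (NLess (cell ''D'' ''i'') (cell ''D'' ''v''))) (NLess (var ''i'') (var ''v''))))))
      (NAssign ''r'' (NAdd (var ''r'') (num 1))) Skip))"

text \<open>\<open>cur\<close> freezes the number of nodes on entry. A loop up to the growing
  \<open>cnt\<close> would also visit the new nodes, whose sets already contain the vertex.\<close>

definition extend_prog :: com where
  "extend_prog = For ''p'' (var ''cur'') (Cond (NLess (cell ''sz'' ''p'') (var ''k''))
    (Seq (NWrite ''par'' (var ''cnt'') (var ''p'')) (Seq (NWrite ''last'' (var ''cnt'') (var ''v''))
      (Seq (NWrite ''sz'' (var ''cnt'') (NAdd (cell ''sz'' ''p'') (num 1)))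
        (NAssign ''cnt'' (NAdd (var ''cnt'') (num 1))))))
    Skip)"

text \<open>Node 0 stands for the empty set. Vertices are treated in index order, and each one of
  rank below \<open>N\<close> extends all stored sets that still have room.\<close>

definition gen_prog :: com where
  "gen_prog = Seq (NWrite ''sz'' (num 0) (num 0)) (Seq (NAssign ''cnt'' (num 1))
    (For ''v'' (var ''n'') (Seq rank_prog (Cond (NLess (var ''r'') (var ''N''))
      (Seq (NAssign ''cur'' (var ''cnt'')) extend_prog) Skip))))"

text \<open>Follows the parent pointers. A set of size \<open>k\<close> is exhausted after exactly
  \<open>k\<close> steps, so no test for a root is made.\<close>

definition load_prog :: com where
  "load_prog = Seq (For ''i'' (var ''n'') (NWrite ''X'' (var ''i'') (num 0)))
    (Seq (NAssign ''q'' (var ''p'')) (For ''i'' (var ''k'')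
      (Seq (NWrite ''X'' (cell ''last'' ''q'') (num 1)) (NAssign ''q'' (cell ''par'' ''q'')))))"

definition enum_prog :: com where
  "enum_prog = For ''p'' (var ''cnt'') (Cond (NLess (cell ''sz'' ''p'') (var ''k'')) Skip
    (Seq load_prog try_X))"

lemma writes_degs_prog [simp]:
  "nwrites degs_prog = {''i'', ''j''}" "awrites degs_prog = {''D''}" "rwrites degs_prog = {}"
  by (auto simp: degs_prog_def)

lemma writes_limit_prog [simp]:
  "nwrites limit_prog = {''i'', ''N''}" "awrites limit_prog = {}" "rwrites limit_prog = {''acc''}"
  by (auto simp: limit_prog_def)

lemma writes_rank_prog [simp]:
  "nwrites rank_prog = {''i'', ''r''}" "awrites rank_prog = {}" "rwrites rank_prog = {}"
  by (auto simp: rank_prog_def)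

lemma writes_extend_prog [simp]:
  "nwrites extend_prog = {''p'', ''cnt''}" "awrites extend_prog = {''par'', ''last'', ''sz''}"
  "rwrites extend_prog = {}"
  by (auto simp: extend_prog_def)

lemma writes_gen_prog [simp]:
  "nwrites gen_prog = {''i'', ''r'', ''p'', ''cnt'', ''v'', ''cur''}"
  "awrites gen_prog = {''par'', ''last'', ''sz''}" "rwrites gen_prog = {}"
  by (auto simp: gen_prog_def)

lemma writes_load_prog [simp]:
  "nwrites load_prog = {''i'', ''q''}" "awrites load_prog = {''X''}" "rwrites load_prog = {}"
  by (auto simp: load_prog_def)

lemma card_less_Suc:
  "card {w. w < Suc j \<and> P w} = (if P j then Suc (card {w. w < j \<and> P w}) else card {w. w < j \<and> P w})"
proof -
  have "{w. w < Suc j \<and> P w} = (if P j then insert j {w. w < j \<and> P w} else {w. w < j \<and> P w})"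
    by (auto simp: less_Suc_eq)
  then show ?thesis by simp
qed

text \<open>
  Subsets are stored as nodes of a forest: node \<open>j\<close> represents the set \<open>rep j\<close>, obtained by adding
  \<open>elt j\<close> to the set of its parent.
\<close>

definition forest ::
  "nat \<Rightarrow> (nat \<Rightarrow> nat) \<Rightarrow> (nat \<Rightarrow> nat) \<Rightarrow> (nat \<Rightarrow> nat) \<Rightarrow> (nat \<Rightarrow> nat set) \<Rightarrow> bool" where
  "forest c sz par elt rep \<longleftrightarrow> inj_on rep {..<c} \<and>
    (\<forall>j<c. sz j = card (rep j) \<and> (rep j \<noteq> {} \<longrightarrow>
      par j < c \<and> elt j \<notin> rep (par j) \<and> rep j = insert (elt j) (rep (par j))))"

text \<open>The premise \<open>new\<close> preserves injectivity of \<open>rep\<close>, through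
  which the number of nodes equals the number of stored sets and can be bounded by counting
  subsets.\<close>

lemma forest_extend:
  assumes "forest c sz par elt rep" "p < c" "v \<notin> rep p" "finite (rep p)"
    and new: "insert v (rep p) \<notin> rep ` {..<c}"
  shows "forest (Suc c) (sz(c := Suc (sz p))) (par(c := p)) (elt(c := v)) (rep(c := insert v (rep p)))"
proof -
  have inj: "inj_on (rep(c := insert v (rep p))) {..<Suc c}"
    unfolding lessThan_Suc
    using assms by (auto simp: forest_def inj_on_def)
  then show ?thesis
    unfolding forest_def using assms by (auto simp: forest_def less_Suc_eq)
qed

definition degs_time :: "nat \<Rightarrow> nat" where
  "degs_time n = 2 + n * ((1 + (2 + n * (2 + 2))) + 2)"

definition limit_time :: "nat \<Rightarrow> nat" where
  "limit_time n = 1 + (1 + (2 + n * (3 + 2)))"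

definition rank_time :: "nat \<Rightarrow> nat" where
  "rank_time n = 1 + (2 + n * (2 + 2))"

text \<open>\<open>M\<close> stands for a bound on the number of nodes.\<close>

definition gen_time :: "nat \<Rightarrow> nat \<Rightarrow> nat" where
  "gen_time n M = 1 + (1 + (2 + n * ((rank_time n + (1 + (1 + (2 + M * (5 + 2))))) + 2)))"

definition load_time :: "nat \<Rightarrow> nat" where
  "load_time n = (2 + n * (1 + 2)) + (1 + (2 + n * (2 + 2)))"

definition enum_time :: "nat \<Rightarrow> nat \<Rightarrow> nat" where
  "enum_time n M = 2 + M * ((1 + (load_time n + try_time n)) + 2)"

context fcgp_input
begin

section \<open>Degrees, size limit and ranks\<close>

lemma runs_degs_prog:
  assumes s: "params s" and T: "degs_time n \<le> T"
  shows "runs E degs_prog s T (\<lambda>s'. \<forall>v<n. real (arrs s' ''D'' v) = degs {v})"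
proof -
  let ?d = "\<lambda>v m. card {w. w < m \<and> {v, w} \<in> E}"
  have d: "real (?d v n) = degs {v}" for v
    by (simp add: arcs_def adj_def Int_def)
  let ?in = "Cond (Adj (var ''i'') (var ''j''))
      (NWrite ''D'' (var ''i'') (NAdd (cell ''D'' ''i'') (num 1))) Skip"
  let ?out = "Seq (NWrite ''D'' (var ''i'') (num 0)) (For ''j'' (var ''n'') ?in)"
  let ?J = "\<lambda>i j s'. \<forall>v. (v < i \<longrightarrow> arrs s' ''D'' v = ?d v n) \<and> (v = i \<longrightarrow> arrs s' ''D'' v = ?d v j)"
  show ?thesis
    unfolding degs_prog_def
  proof (rule runs_For [where I = "\<lambda>i s'. \<forall>v<i. arrs s' ''D'' v = ?d v n" and m = n])
    fix i s1 assume i: "i < n" and fr: "frame (For ''i'' (var ''n'') ?out) s s1"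
      and vi: "nvars s1 ''i'' = i" and I: "\<forall>v<i. arrs s1 ''D'' v = ?d v n"
    have n1: "nvars s1 ''n'' = n" using fr s by (auto simp: frame_def params_def)
    show "runs E ?out s1 (1 + (2 + n * (2 + 2)))
      (\<lambda>s'. \<forall>v<Suc i. arrs (s'\<lparr>nvars := (nvars s')(''i'' := Suc i)\<rparr>) ''D'' v = ?d v n)"
    proof (rule runs_Seq [OF runs_NWrite [OF order_refl] order_refl])
      let ?s = "s1\<lparr>arrs := (arrs s1)(''D'' := (arrs s1 ''D'')(nval (var ''i'') s1 := nval (num 0) s1))\<rparr>"
      show "runs E (For ''j'' (var ''n'') ?in) ?s (2 + n * (2 + 2))
        (\<lambda>s'. \<forall>v<Suc i. arrs (s'\<lparr>nvars := (nvars s')(''i'' := Suc i)\<rparr>) ''D'' v = ?d v n)"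
      proof (rule runs_For [where I = "?J i" and m = n])
        fix j s2 assume fr2: "frame (For ''j'' (var ''n'') ?in) ?s s2"
          and vj: "nvars s2 ''j'' = j" and J: "?J i j s2"
        have "nvars s2 ''i'' = i" using fr2 vi by (auto simp: frame_def)
        then show "runs E ?in s2 2 (\<lambda>s'. ?J i (Suc j) (s'\<lparr>nvars := (nvars s')(''j'' := Suc j)\<rparr>))"
          using vj J by (intro runs_Cond [where T' = 1] runs_NWrite runs_Skip) (auto simp: card_less_Suc)
      next
        show "?J i 0 (?s\<lparr>nvars := (nvars ?s)(''j'' := 0)\<rparr>)" using I vi by auto
      qed (use n1 in \<open>auto simp: frame_def less_Suc_eq\<close>)
    qed
  next
    fix s' assume "\<forall>v<n. arrs s' ''D'' v = ?d v n"
    then show "\<forall>v<n. real (arrs s' ''D'' v) = degs {v}" using d by simp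
  qed (use s T in \<open>auto simp: frame_def params_def degs_time_def\<close>)
qed

text \<open>The first conjunct serves the approximation guarantee. The second says that
  \<open>L - 1\<close> falls short of the threshold, which keeps \<open>L\<close> small and serves
  the time bound.\<close>

definition limit :: "nat \<Rightarrow> bool" where
  "limit L \<longleftrightarrow> (L = n \<or> 9 \<le> L * \<epsilon>) \<and> (0 < L \<longrightarrow> (real L - 1) * \<epsilon> < 9)"

text \<open>In the absence of multiplication and division, \<open>L * \<epsilon>\<close> and
  \<open>k * L\<close> are built up by repeated addition; \<open>L\<close> itself is no program
  variable and exists only as a witness in the invariant.\<close>

lemma runs_limit_prog:
  assumes s: "params s" and T: "limit_time n \<le> T"
  shows "runs E limit_prog s T (\<lambda>s'. \<exists>L. nvars s' ''N'' = k * L \<and> limit L)"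
proof -
  let ?b = "Cond (RLess (RVar ''acc'') (ROfNat (num 9)))
      (Seq (RAssign ''acc'' (RAdd (RVar ''acc'') (RVar ''eps'')))
        (NAssign ''N'' (NAdd (var ''N'') (var ''k'')))) Skip"
  let ?s = "s\<lparr>nvars := (nvars s)(''N'' := 0), rvars := (rvars s)(''acc'' := 0)\<rparr>"
  let ?I = "\<lambda>i s'. \<exists>L. rvars s' ''acc'' = L * \<epsilon> \<and> nvars s' ''N'' = k * L \<and>
    (L = i \<or> 9 \<le> L * \<epsilon>) \<and> (0 < L \<longrightarrow> (real L - 1) * \<epsilon> < 9)"
  have "runs E (For ''i'' (var ''n'') ?b) ?s (2 + n * (3 + 2))
    (\<lambda>s'. \<exists>L. nvars s' ''N'' = k * L \<and> limit L)"
  proof (rule runs_For [where I = ?I and m = n])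
    fix i s1 assume fr: "frame (For ''i'' (var ''n'') ?b) ?s s1" and "?I i s1"
    then obtain L where L: "rvars s1 ''acc'' = L * \<epsilon>" "nvars s1 ''N'' = k * L"
      "L = i \<or> 9 \<le> L * \<epsilon>" "0 < L \<longrightarrow> (real L - 1) * \<epsilon> < 9" by auto
    have s1: "nvars s1 ''k'' = k" "rvars s1 ''eps'' = \<epsilon>"
      using fr s by (auto simp: frame_def params_def)
    show "runs E ?b s1 3 (\<lambda>s'. ?I (Suc i) (s'\<lparr>nvars := (nvars s')(''i'' := Suc i)\<rparr>))"
    proof (rule runs_Cond [where T' = 2])
      assume "bval E (RLess (RVar ''acc'') (ROfNat (num 9))) s1"
      then have "L * \<epsilon> < 9" using L by simp
      then show "runs E (Seq (RAssign ''acc'' (RAdd (RVar ''acc'') (RVar ''eps'')))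
          (NAssign ''N'' (NAdd (var ''N'') (var ''k'')))) s1 2
        (\<lambda>s'. ?I (Suc i) (s'\<lparr>nvars := (nvars s')(''i'' := Suc i)\<rparr>))"
        using L s1
        by (intro runs_Seq [OF runs_RAssign [OF order_refl runs_NAssign [OF order_refl]]] exI [of _ "Suc L"])
           (auto simp: algebra_simps)
    next
      assume "\<not> bval E (RLess (RVar ''acc'') (ROfNat (num 9))) s1"
      then show "runs E Skip s1 2 (\<lambda>s'. ?I (Suc i) (s'\<lparr>nvars := (nvars s')(''i'' := Suc i)\<rparr>))"
        using L by (intro runs_Skip exI [of _ L]) auto
    qed simp
  next
    show "?I 0 (?s\<lparr>nvars := (nvars ?s)(''i'' := 0)\<rparr>)"
      by (intro exI [of _ 0]) simp
  next
    fix s' assume "?I n s'"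
    then show "\<exists>L. nvars s' ''N'' = k * L \<and> limit L"
      unfolding limit_def by blast
  qed (use s in \<open>simp_all add: frame_def params_def\<close>)
  then show ?thesis
    unfolding limit_prog_def
    by (intro runs_Seq [OF runs_NAssign [OF order_refl runs_Seq [OF runs_RAssign [OF order_refl] order_refl]]])
       (use T in \<open>auto simp: limit_time_def\<close>)
qed

lemma runs_rank_prog:
  assumes s: "params s" and T: "rank_time n \<le> T"
  shows "runs E rank_prog s T (\<lambda>s'. nvars s' ''r'' = rank (arrs s ''D'') n (nvars s ''v''))"
  unfolding rank_prog_def
proof (rule runs_Seq [OF runs_NAssign [OF order_refl]])
  let ?b = "Cond (BNot (BAnd (BNot (NLess (cell ''D'' ''v'') (cell ''D'' ''i'')))
        (BNot (BAnd (BNot (NLess (cell ''D'' ''i'') (cell ''D'' ''v''))) (NLess (var ''i'') (var ''v''))))))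
      (NAssign ''r'' (NAdd (var ''r'') (num 1))) Skip"
  let ?s = "s\<lparr>nvars := (nvars s)(''r'' := nval (num 0) s)\<rparr>"
  let ?P = "\<lambda>u. ahead (arrs s ''D'') u (nvars s ''v'')"
  show "runs E (For ''i'' (var ''n'') ?b) ?s (2 + n * (2 + 2))
    (\<lambda>s'. nvars s' ''r'' = rank (arrs s ''D'') n (nvars s ''v''))"
  proof (rule runs_For [where I = "\<lambda>i s'. nvars s' ''r'' = card {u. u < i \<and> ?P u}" and m = n])
    fix i s1 assume fr: "frame (For ''i'' (var ''n'') ?b) ?s s1" and vi: "nvars s1 ''i'' = i"
      and I: "nvars s1 ''r'' = card {u. u < i \<and> ?P u}"
    have s1: "nvars s1 ''v'' = nvars s ''v''" "arrs s1 ''D'' = arrs s ''D''"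
      using fr by (auto simp: frame_def)
    show "runs E ?b s1 2 (\<lambda>s'. nvars (s'\<lparr>nvars := (nvars s')(''i'' := Suc i)\<rparr>) ''r''
        = card {u. u < Suc i \<and> ?P u})"
      unfolding card_less_Suc using I s1 vi
      by (intro runs_Cond [where T' = 1] runs_NAssign runs_Skip) (auto simp: ahead_def)
  qed (use s in \<open>auto simp: frame_def params_def rank_def\<close>)
qed (use T in \<open>simp add: rank_time_def\<close>)

section \<open>Families of small sets and their generation\<close>

definition small :: "nat set \<Rightarrow> nat \<Rightarrow> nat set set" where
  "small T m = {U. U \<subseteq> T \<inter> {..<m} \<and> card U \<le> k}"

text \<open>A new set contains \<open>v\<close> and comes from the smaller set without
  \<open>v\<close>; this is the recursion that \<open>extend_prog\<close> carries out.\<close>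

lemma small_Suc_in:
  assumes "v \<in> T"
  shows "small T (Suc v) = small T v \<union> insert v ` {U \<in> small T v. card U < k}"
proof (intro equalityI subsetI)
  fix U assume U: "U \<in> small T (Suc v)"
  then have fin: "finite U" by (auto simp: small_def intro: finite_subset [of _ "{..<Suc v}"])
  show "U \<in> small T v \<union> insert v ` {U \<in> small T v. card U < k}"
  proof (cases "v \<in> U")
    case True
    then have "Suc (card (U - {v})) = card U" using card.remove [OF fin True] by simp
    then have "U - {v} \<in> {U \<in> small T v. card U < k}"
      using U by (auto simp: small_def less_Suc_eq)
    then have "insert v (U - {v}) \<in> insert v ` {U \<in> small T v. card U < k}" by (rule imageI)
    then show ?thesis unfolding insert_Diff [OF True] by (rule UnI2)
  qed (use U in \<open>auto simp: small_def less_Suc_eq\<close>)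
next
  fix U assume "U \<in> small T v \<union> insert v ` {U \<in> small T v. card U < k}"
  then show "U \<in> small T (Suc v)"
    using assms by (auto simp: small_def less_Suc_eq intro: le_trans [OF card_insert_le_m1])
qed

lemma small_Suc_notin: "v \<notin> T \<Longrightarrow> small T (Suc v) = small T v"
  by (simp add: small_def lessThan_Suc)

lemma small_0: "small T 0 = {{}}"
  by (auto simp: small_def)

lemma finite_small: "finite (small T m)"
  by (rule finite_subset [of _ "Pow {..<m}"]) (auto simp: small_def)

lemma small_mono: "m \<le> m' \<Longrightarrow> small T m \<subseteq> small T m'"
  by (auto simp: small_def)

abbreviation stored :: "state \<Rightarrow> (nat \<Rightarrow> nat set) \<Rightarrow> bool" where
  "stored s rep \<equiv> forest (nvars s ''cnt'') (arrs s ''sz'') (arrs s ''par'') (arrs s ''last'') rep"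

lemma runs_extend_prog:
  assumes s: "params s" "nvars s ''cur'' = c" "nvars s ''cnt'' = c" "nvars s ''v'' = v"
    and rep: "stored s rep" "\<And>q. q < c \<Longrightarrow> v \<notin> rep q \<and> finite (rep q)"
    and T: "2 + c * (5 + 2) \<le> T"
  shows "runs E extend_prog s T (\<lambda>s'. \<exists>rep'. stored s' rep' \<and>
    rep' ` {..<nvars s' ''cnt''} = rep ` {..<c} \<union> insert v ` {U \<in> rep ` {..<c}. card U < k})"
proof -
  let ?b = "Cond (NLess (cell ''sz'' ''p'') (var ''k''))
    (Seq (NWrite ''par'' (var ''cnt'') (var ''p'')) (Seq (NWrite ''last'' (var ''cnt'') (var ''v''))
      (Seq (NWrite ''sz'' (var ''cnt'') (NAdd (cell ''sz'' ''p'') (num 1)))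
        (NAssign ''cnt'' (NAdd (var ''cnt'') (num 1))))))
    Skip"
  let ?F = "\<lambda>p. rep ` {..<c} \<union> insert v ` {U \<in> rep ` {..<p}. card U < k}"
  \<comment> \<open>Nodes below \<open>c\<close> keep their sets, so later iterations still extend
    the family present on entry.\<close>
  let ?G = "\<lambda>p c' rep'. c \<le> c' \<and> (\<forall>q<c. rep' q = rep q) \<and> rep' ` {..<c'} = ?F p"
  let ?I = "\<lambda>p s'. \<exists>rep'. stored s' rep' \<and> ?G p (nvars s' ''cnt'') rep'"
  show ?thesis
    unfolding extend_prog_def
  proof (rule runs_For [where I = ?I and m = c])
    show "?I 0 (s\<lparr>nvars := (nvars s)(''p'' := 0)\<rparr>)"
      using rep s by (intro exI [of _ rep]) auto
  next
    fix p s1 assume p: "p < c" and fr: "frame (For ''p'' (var ''cur'') ?b) s s1"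
      and vp: "nvars s1 ''p'' = p" and I: "?I p s1"
    define c' where "c' = nvars s1 ''cnt''"
    obtain rep' where "stored s1 rep' \<and> ?G p (nvars s1 ''cnt'') rep'" using I by (rule exE)
    then have r': "stored s1 rep'" and c': "nvars s1 ''cnt'' = c'" and G: "?G p c' rep'"
      unfolding c'_def by simp_all
    have s1: "nvars s1 ''k'' = k" "nvars s1 ''v'' = v"
      using fr s by (auto simp: frame_def params_def)
    have sz: "arrs s1 ''sz'' p = card (rep p)"
      using r' p G c' by (auto simp: forest_def)
    have F: "?F (Suc p) = (if card (rep p) < k then insert (insert v (rep p)) (?F p) else ?F p)"
      by (auto simp: less_Suc_eq)
    show "runs E ?b s1 5 (\<lambda>s'. ?I (Suc p) (s'\<lparr>nvars := (nvars s')(''p'' := Suc p)\<rparr>))"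
    proof (rule runs_Cond [where T' = 4])
      assume "bval E (NLess (cell ''sz'' ''p'') (var ''k'')) s1"
      then have lt: "card (rep p) < k" by (simp add: sz s1 vp)
      define rep'' where "rep'' = rep'(c' := insert v (rep p))"
      \<comment> \<open>Old sets avoid \<open>v\<close>, and inserting \<open>v\<close> is injective
        on sets that avoid it; so the new set has no node yet.\<close>
      have "insert v (rep p) \<notin> ?F p"
      proof
        assume "insert v (rep p) \<in> ?F p"
        then obtain q where q: "q < p" "insert v (rep p) = insert v (rep q)"
          using rep(2) by auto
        then have "rep p = rep q" using rep(2) [of p] rep(2) [of q] p by auto
        moreover have "inj_on rep {..<c}" using rep(1) s(3) by (simp add: forest_def)
        ultimately have "p = q" using p q(1) by (simp add: inj_on_eq_iff)
        then show False using q(1) by simp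
      qed
      then have "forest (Suc c') ((arrs s1 ''sz'')(c' := Suc (arrs s1 ''sz'' p)))
          ((arrs s1 ''par'')(c' := p)) ((arrs s1 ''last'')(c' := v)) rep''"
        using forest_extend [of c' "arrs s1 ''sz''" "arrs s1 ''par''" "arrs s1 ''last''" rep' p v]
          r' c' G p rep(2) [OF p] by (simp add: rep''_def)
      moreover have "?G (Suc p) (Suc c') rep''"
      proof (intro conjI allI impI)
        have "rep'' ` {..<Suc c'} = insert (insert v (rep p)) (rep' ` {..<c'})"
          unfolding lessThan_Suc by (auto simp: rep''_def)
        then show "rep'' ` {..<Suc c'} = ?F (Suc p)" using F lt G by simp
      qed (use G in \<open>auto simp: rep''_def\<close>)
      ultimately show "runs E (Seq (NWrite ''par'' (var ''cnt'') (var ''p'')) (Seq (NWrite ''last'' (var ''cnt'') (var ''v''))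
          (Seq (NWrite ''sz'' (var ''cnt'') (NAdd (cell ''sz'' ''p'') (num 1)))
            (NAssign ''cnt'' (NAdd (var ''cnt'') (num 1)))))) s1 4
         (\<lambda>s'. ?I (Suc p) (s'\<lparr>nvars := (nvars s')(''p'' := Suc p)\<rparr>))"
        using c' vp s1
        by (intro runs_Seq [OF runs_NWrite [OF order_refl runs_Seq [OF runs_NWrite [OF order_refl
                runs_Seq [OF runs_NWrite [OF order_refl runs_NAssign [OF order_refl]] order_refl]]
              order_refl]]] exI [of _ rep'']) simp_all
    next
      assume "\<not> bval E (NLess (cell ''sz'' ''p'') (var ''k'')) s1"
      then have "\<not> card (rep p) < k" by (simp add: sz s1 vp)
      then show "runs E Skip s1 4 (\<lambda>s'. ?I (Suc p) (s'\<lparr>nvars := (nvars s')(''p'' := Suc p)\<rparr>))"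
        using r' c' G F by (intro runs_Skip exI [of _ rep']) simp_all
    qed simp
  qed (use s T in \<open>auto simp: frame_def\<close>)
qed

lemma runs_gen_prog:
  assumes s: "params s"
  defines "R \<equiv> top_set (arrs s ''D'') n (nvars s ''N'')"
  assumes M: "card (small R n) \<le> M" and T: "gen_time n M \<le> T"
  shows "runs E gen_prog s T (\<lambda>s'. \<exists>rep. stored s' rep \<and> rep ` {..<nvars s' ''cnt''} = small R n)"
proof -
  let ?c = "Cond (NLess (var ''r'') (var ''N'')) (Seq (NAssign ''cur'' (var ''cnt'')) extend_prog) Skip"
  let ?b = "Seq rank_prog ?c"
  define s0 where "s0 = s\<lparr>arrs := (arrs s)(''sz'' := (arrs s ''sz'')(0 := 0)), nvars := (nvars s)(''cnt'' := 1)\<rparr>"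
  let ?I = "\<lambda>m s'. \<exists>rep. stored s' rep \<and> rep ` {..<nvars s' ''cnt''} = small R m"
  have "runs E (For ''v'' (var ''n'') ?b) s0 (2 + n * ((rank_time n + (1 + (1 + (2 + M * (5 + 2))))) + 2)) (?I n)"
  proof (rule runs_For [where I = ?I and m = n])
    have "forest 1 (arrs s0 ''sz'') (arrs s0 ''par'') (arrs s0 ''last'') (\<lambda>_. {})"
      by (simp add: forest_def inj_on_def s0_def)
    then show "?I 0 (s0\<lparr>nvars := (nvars s0)(''v'' := 0)\<rparr>)"
      by (intro exI [of _ "\<lambda>_. {}"]) (auto simp: s0_def small_0)
  next
    fix v s1 assume v: "v < n" and fr: "frame (For ''v'' (var ''n'') ?b) s0 s1"
      and vv: "nvars s1 ''v'' = v" and "?I v s1"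
    then obtain rep where rep: "stored s1 rep" "rep ` {..<nvars s1 ''cnt''} = small R v" by blast
    define c where "c = nvars s1 ''cnt''"
    have p1: "params s1" "arrs s1 ''D'' = arrs s ''D''" "nvars s1 ''N'' = nvars s ''N''"
      using fr s by (auto simp: frame_def params_def s0_def)
    \<comment> \<open>By injectivity of \<open>rep\<close> there are as many nodes as sets, so the
      pass over all nodes makes at most \<open>M\<close> iterations.\<close>
    have "c = card (small R v)"
      using rep card_image [of rep "{..<c}"] by (simp add: forest_def c_def)
    also have "\<dots> \<le> M"
      using M v card_mono [OF finite_small small_mono [of v n R]] by simp
    finally have c: "c \<le> M" .
    show "runs E ?b s1 (rank_time n + (1 + (1 + (2 + M * (5 + 2)))))
      (\<lambda>s'. ?I (Suc v) (s'\<lparr>nvars := (nvars s')(''v'' := Suc v)\<rparr>))"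
    proof (rule runs_Seq [OF _ order_refl], rule runs_conseq [OF runs_rank_prog [OF p1(1) order_refl] order_refl])
      fix s2 assume fr2: "frame rank_prog s1 s2"
        and r: "nvars s2 ''r'' = rank (arrs s1 ''D'') n (nvars s1 ''v'')"
      have p2: "params s2" using fr2 by (rule params_frame [OF p1(1)]) auto
      have s2: "nvars s2 ''v'' = v" "nvars s2 ''cnt'' = c" "nvars s2 ''N'' = nvars s ''N''"
        "stored s2 rep" "nvars s2 ''r'' = rank (arrs s ''D'') n v"
        using fr2 vv rep p1 r by (auto simp: frame_def c_def)
      show "runs E ?c s2 (1 + (1 + (2 + M * (5 + 2))))
        (\<lambda>s'. ?I (Suc v) (s'\<lparr>nvars := (nvars s')(''v'' := Suc v)\<rparr>))"
      proof (rule runs_Cond [OF _ _ order_refl])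
        assume "bval E (NLess (var ''r'') (var ''N'')) s2"
        then have vR: "v \<in> R" using v s2 by (simp add: R_def top_set_def)
        define s3 where "s3 = s2\<lparr>nvars := (nvars s2)(''cur'' := c)\<rparr>"
        have s3: "params s3" "nvars s3 ''cur'' = c" "nvars s3 ''cnt'' = c" "nvars s3 ''v'' = v" "stored s3 rep"
          using s2 p2 by (auto simp: s3_def params_def)
        have q: "v \<notin> rep q \<and> finite (rep q)" if "q < c" for q
        proof -
          have "rep q \<in> small R v" using that rep(2) by (auto simp: c_def)
          then show ?thesis by (auto simp: small_def intro: finite_subset [of _ "{..<v}"])
        qed
        have "runs E extend_prog s3 (2 + M * (5 + 2)) (\<lambda>s'. \<exists>rep'. stored s' rep' \<and>
          rep' ` {..<nvars s' ''cnt''} = rep ` {..<c} \<union> insert v ` {U \<in> rep ` {..<c}. card U < k})"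
          by (rule runs_extend_prog [OF s3 q]) (use c in simp_all)
        then show "runs E (Seq (NAssign ''cur'' (var ''cnt'')) extend_prog) s2 (1 + (2 + M * (5 + 2)))
          (\<lambda>s'. ?I (Suc v) (s'\<lparr>nvars := (nvars s')(''v'' := Suc v)\<rparr>))"
          using s2(2) rep(2)
          by (intro runs_Seq [OF runs_NAssign [OF order_refl] order_refl])
             (simp add: s3_def small_Suc_in [OF vR] c_def)
      next
        assume "\<not> bval E (NLess (var ''r'') (var ''N'')) s2"
        then have vR: "v \<notin> R" using s2 by (simp add: R_def top_set_def)
        show "runs E Skip s2 (1 + (2 + M * (5 + 2)))
          (\<lambda>s'. ?I (Suc v) (s'\<lparr>nvars := (nvars s')(''v'' := Suc v)\<rparr>))"
          using s2 rep(2) by (intro runs_Skip exI [of _ rep]) (simp_all add: small_Suc_notin [OF vR] c_def)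
      qed
    qed
  qed (use s in \<open>auto simp: frame_def params_def s0_def\<close>)
  then show ?thesis
    unfolding gen_prog_def
    by (intro runs_Seq [OF runs_NWrite [OF order_refl runs_Seq [OF runs_NAssign [OF order_refl] order_refl]]])
       (use T in \<open>auto simp: gen_time_def s0_def\<close>)
qed

lemma runs_load_prog:
  assumes s: "params s" "nvars s ''p'' = p" "p < c" and c: "nvars s ''cnt'' = c"
    and rep: "stored s rep" "rep p \<subseteq> {..<n}" "card (rep p) = k"
    and T: "load_time n \<le> T"
  shows "runs E load_prog s T (\<lambda>s'. supp n (arrs s' ''X'') = rep p)"
  unfolding load_prog_def
proof (rule runs_Seq)
  let ?clear = "For ''i'' (var ''n'') (NWrite ''X'' (var ''i'') (num 0))"
  let ?b = "Seq (NWrite ''X'' (cell ''last'' ''q'') (num 1)) (NAssign ''q'' (cell ''par'' ''q''))"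
  let ?w = "For ''i'' (var ''k'') ?b"
  let ?Q = "\<lambda>s'. supp n (arrs s' ''X'') = rep p"
  show "runs E ?clear s (2 + n * (1 + 2))
    (\<lambda>s'. runs E (Seq (NAssign ''q'' (var ''p'')) ?w) s' (1 + (2 + n * (2 + 2))) ?Q)"
  proof (rule runs_For [where I = "\<lambda>i s'. \<forall>v<i. arrs s' ''X'' v = 0" and m = n])
    fix s1 assume fr: "frame ?clear s s1" and X: "\<forall>v<n. arrs s1 ''X'' v = 0"
    define s2 where "s2 = s1\<lparr>nvars := (nvars s1)(''q'' := p)\<rparr>"
    have s2: "nvars s2 ''k'' = k" "arrs s2 ''par'' = arrs s ''par''" "arrs s2 ''last'' = arrs s ''last''"
      "nvars s2 ''q'' = p" "supp n (arrs s2 ''X'') = {}"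
      using fr s X by (auto simp: frame_def params_def s2_def supp_def)
    \<comment> \<open>The vertices already loaded and the set of the current node together make up
      \<open>rep p\<close>; that set has \<open>k - i\<close> elements left and is empty at the
      end.\<close>
    let ?I = "\<lambda>i s'. nvars s' ''q'' < c \<and> card (rep (nvars s' ''q'')) = k - i \<and>
      supp n (arrs s' ''X'') \<union> rep (nvars s' ''q'') = rep p"
    have "runs E ?w s2 (2 + n * (2 + 2)) ?Q"
    proof (rule runs_For [where I = ?I and m = k])
      fix i s3 assume i: "i < k" and fr3: "frame ?w s2 s3" and I: "?I i s3"
      define q where "q = nvars s3 ''q''"
      have s3: "arrs s3 ''par'' = arrs s ''par''" "arrs s3 ''last'' = arrs s ''last''"
        using fr3 s2 by (auto simp: frame_def)
      have "rep q \<noteq> {}" using I i by (auto simp: q_def)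
      then have q: "arrs s ''par'' q < c" "arrs s ''last'' q \<notin> rep (arrs s ''par'' q)"
        "rep q = insert (arrs s ''last'' q) (rep (arrs s ''par'' q))"
        using rep(1) I c by (auto simp: forest_def q_def)
      have sub: "rep q \<subseteq> rep p" using I by (auto simp: q_def)
      have fin: "finite (rep q)" by (rule finite_subset [OF subset_trans [OF sub rep(2)]]) simp
      have "card (rep q) = Suc (card (rep (arrs s ''par'' q)))"
        using fin q by (metis card_insert_disjoint finite_insert)
      then have cd: "card (rep (arrs s ''par'' q)) = k - Suc i" using I by (simp add: q_def)
      have "arrs s ''last'' q < n" using q(3) sub rep(2) by auto
      then have "supp n ((arrs s3 ''X'')(arrs s ''last'' q := 1)) \<union> rep (arrs s ''par'' q) = supp n (arrs s3 ''X'') \<union> rep q"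
        unfolding q(3) by (auto simp: supp_def)
      then have un: "supp n ((arrs s3 ''X'')(arrs s ''last'' q := 1)) \<union> rep (arrs s ''par'' q) = rep p"
        using I by (simp add: q_def)
      show "runs E ?b s3 2 (\<lambda>s'. ?I (Suc i) (s'\<lparr>nvars := (nvars s')(''i'' := Suc i)\<rparr>))"
        using q(1) cd un s3
        by (intro runs_Seq [OF runs_NWrite [OF order_refl runs_NAssign [OF order_refl]]]) (simp_all add: q_def)
    next
      show "?I 0 (s2\<lparr>nvars := (nvars s2)(''i'' := 0)\<rparr>)" using s2 s rep by simp
    next
      fix s' assume I: "?I k s'"
      then have "rep (nvars s' ''q'') \<subseteq> {..<n}" using rep(2) by auto
      then have "finite (rep (nvars s' ''q''))" by (rule finite_subset) simp
      then show "?Q s'" using I by auto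
    qed (use s2 k_le in \<open>auto simp: frame_def\<close>)
    then show "runs E (Seq (NAssign ''q'' (var ''p'')) ?w) s1 (1 + (2 + n * (2 + 2))) ?Q"
      using fr s by (intro runs_Seq [OF runs_NAssign [OF order_refl] order_refl]) (auto simp: s2_def frame_def)
  qed (use s in \<open>auto simp: frame_def params_def less_Suc_eq intro!: runs_NWrite\<close>)
qed (use T in \<open>simp add: load_time_def\<close>)

lemma runs_enum_prog:
  assumes g: "good s" and rep: "stored s rep" "rep ` {..<nvars s ''cnt''} = small R n"
    and M: "card (small R n) \<le> M" and T: "enum_time n M \<le> T" and R: "R \<subseteq> {..<n}"
  shows "runs E enum_prog s T (\<lambda>s'. good s' \<and> f (output_set s) \<le> f (output_set s') \<and>
    (\<forall>U. U \<subseteq> R \<longrightarrow> card U = k \<longrightarrow> f U \<le> f (output_set s')))"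
proof -
  define c where "c = nvars s ''cnt''"
  have "c = card (small R n)"
    using rep card_image [of rep "{..<c}"] by (simp add: forest_def c_def)
  then have c: "c \<le> M" using M by simp
  have best: "rvars s' ''best'' = 2 * f (output_set s')" if "good s'" for s'
    using that by (simp add: good_def)
  let ?b = "Cond (NLess (cell ''sz'' ''p'') (var ''k'')) Skip (Seq load_prog try_X)"
  let ?I = "\<lambda>p s'. good s' \<and> rvars s ''best'' \<le> rvars s' ''best'' \<and>
    (\<forall>q<p. card (rep q) = k \<longrightarrow> 2 * f (rep q) \<le> rvars s' ''best'')"
  show ?thesis
    unfolding enum_prog_def
  proof (rule runs_For [where I = ?I and m = c and T = "1 + (load_time n + try_time n)"])
    fix p s1 assume p: "p < c" and fr: "frame (For ''p'' (var ''cnt'') ?b) s s1"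
      and vp: "nvars s1 ''p'' = p" and I: "?I p s1"
    have s1: "nvars s1 ''k'' = k" "arrs s1 ''sz'' p = card (rep p)" "stored s1 rep" "nvars s1 ''cnt'' = c"
      using fr rep(1) p g by (auto simp: frame_def good_def params_def forest_def c_def)
    have "rep p \<in> small R n" using p rep(2) by (auto simp: c_def)
    then have sm: "rep p \<subseteq> {..<n}" "card (rep p) \<le> k" by (auto simp: small_def)
    show "runs E ?b s1 (1 + (load_time n + try_time n))
      (\<lambda>s'. ?I (Suc p) (s'\<lparr>nvars := (nvars s')(''p'' := Suc p)\<rparr>))"
    proof (rule runs_Cond [OF _ _ order_refl])
      assume "bval E (NLess (cell ''sz'' ''p'') (var ''k'')) s1"
      then show "runs E Skip s1 (load_time n + try_time n)
        (\<lambda>s'. ?I (Suc p) (s'\<lparr>nvars := (nvars s')(''p'' := Suc p)\<rparr>))"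
        using I by (intro runs_Skip) (auto simp: s1 vp less_Suc_eq try_time_def)
    next
      assume "\<not> bval E (NLess (cell ''sz'' ''p'') (var ''k'')) s1"
      \<comment> \<open>All stored sets have size at most \<open>k\<close>, so failing the guard
        means size exactly \<open>k\<close>.\<close>
      then have ck: "card (rep p) = k" using sm by (simp add: s1 vp)
      have p1: "params s1" using I by (simp add: good_def)
      show "runs E (Seq load_prog try_X) s1 (load_time n + try_time n)
        (\<lambda>s'. ?I (Suc p) (s'\<lparr>nvars := (nvars s')(''p'' := Suc p)\<rparr>))"
      proof (rule runs_Seq [OF _ order_refl],
          rule runs_conseq [OF runs_load_prog [OF p1 vp p s1(4,3) sm(1) ck order_refl] order_refl])
        fix s2 assume fr2: "frame load_prog s1 s2" and X: "supp n (arrs s2 ''X'') = rep p"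
        have g2: "good s2" by (rule good_frame [OF conjunct1 [OF I] fr2]) auto
        have b2: "rvars s2 ''best'' = rvars s1 ''best''" using fr2 by (simp add: frame_def)
        show "runs E try_X s2 (try_time n) (\<lambda>s'. ?I (Suc p) (s'\<lparr>nvars := (nvars s')(''p'' := Suc p)\<rparr>))"
        proof (rule runs_conseq [OF runs_try_good [OF g2 X ck order_refl] order_refl], goal_cases)
          case (1 s3)
          then have "rvars s1 ''best'' \<le> rvars s3 ''best''" "2 * f (rep p) \<le> rvars s3 ''best''"
            by (auto simp: b2 split: if_splits)
          then show ?case using 1(2) I by (auto simp: less_Suc_eq intro: order_trans)
        qed
      qed
    qed
  next
    fix s' assume I: "?I c s'"
    have "f U \<le> f (output_set s')" if "U \<subseteq> R" "card U = k" for U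
    proof -
      have "U \<in> small R n" using that R by (auto simp: small_def)
      then obtain q where "q < c" "U = rep q" using rep(2) by (auto simp: c_def)
      then show ?thesis using I that best [of s'] by auto
    qed
    then show "good s' \<and> f (output_set s) \<le> f (output_set s') \<and>
      (\<forall>U. U \<subseteq> R \<longrightarrow> card U = k \<longrightarrow> f U \<le> f (output_set s'))"
      using I best g by auto
  next
    have "c * ((1 + (load_time n + try_time n)) + 2) \<le> M * ((1 + (load_time n + try_time n)) + 2)"
      using c by (rule mult_le_mono1)
    then show "2 + c * ((1 + (load_time n + try_time n)) + 2) \<le> T"
      using T unfolding enum_time_def by linarith
  next
    show "?I 0 (s\<lparr>nvars := (nvars s)(''p'' := 0)\<rparr>)" using g by simp
  qed (auto simp: frame_def c_def)
qed

end

section \<open>The approximation scheme\<close>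

text \<open>The guard tests \<open>\<epsilon> < 2 / 3\<close> by additions only. In that case the
  enumeration starts from the result of the local search and can only improve it.\<close>

definition main_prog :: com where
  "main_prog = Seq local_prog
    (Cond (RLess (RAdd (RVar ''eps'') (RAdd (RVar ''eps'') (RVar ''eps''))) (ROfNat (num 2)))
      (Seq degs_prog (Seq limit_prog (Seq gen_prog enum_prog))) Skip)"

definition main_time :: "nat \<Rightarrow> nat \<Rightarrow> nat" where
  "main_time n M = local_time n +
    (1 + (degs_time n + (limit_time n + (gen_time n M + enum_time n M))))"

section \<open>Polynomial bounds\<close>

definition poly_bounded :: "(nat \<Rightarrow> nat) \<Rightarrow> bool" where
  "poly_bounded f \<longleftrightarrow> (\<exists>C b. \<forall>n. f n \<le> C * max 1 n ^ b)"

lemma poly_bounded_const: "poly_bounded (\<lambda>n. c)"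
  unfolding poly_bounded_def by (intro exI [of _ c] exI [of _ 0]) simp

lemma poly_bounded_id: "poly_bounded (\<lambda>n. n)"
  unfolding poly_bounded_def by (intro exI [of _ 1]) simp

lemma poly_bounded_add:
  assumes "poly_bounded f" "poly_bounded g"
  shows "poly_bounded (\<lambda>n. f n + g n)"
proof -
  obtain C b D d where f: "\<And>n. f n \<le> C * max 1 n ^ b" and g: "\<And>n. g n \<le> D * max 1 n ^ d"
    using assms unfolding poly_bounded_def by blast
  have "f n + g n \<le> (C + D) * max 1 n ^ (b + d)" for n
  proof -
    have "f n + g n \<le> C * max 1 n ^ b + D * max 1 n ^ d" using f g by (rule add_mono)
    also have "\<dots> \<le> C * max 1 n ^ (b + d) + D * max 1 n ^ (b + d)"
      by (intro add_mono mult_le_mono2 power_increasing) simp_all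
    finally show ?thesis by (simp only: add_mult_distrib)
  qed
  then show ?thesis unfolding poly_bounded_def by blast
qed

lemma poly_bounded_mult:
  assumes "poly_bounded f" "poly_bounded g"
  shows "poly_bounded (\<lambda>n. f n * g n)"
proof -
  obtain C b D d where f: "\<And>n. f n \<le> C * max 1 n ^ b" and g: "\<And>n. g n \<le> D * max 1 n ^ d"
    using assms unfolding poly_bounded_def by blast
  have "f n * g n \<le> (C * D) * max 1 n ^ (b + d)" for n
    using mult_le_mono [OF f g, of n n] by (simp add: power_add mult_ac)
  then show ?thesis unfolding poly_bounded_def by blast
qed

lemma poly_bounded_Suc: "poly_bounded f \<Longrightarrow> poly_bounded (\<lambda>n. Suc (f n))"
  using poly_bounded_add [OF poly_bounded_const [of 1]] by simp

lemma poly_bounded_main_time: "poly_bounded (\<lambda>n. main_time n 1)"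
  unfolding main_time_def local_time_def degs_time_def limit_time_def gen_time_def enum_time_def
    load_time_def rank_time_def round_time_def swap_time_def try_time_def eval_time_def
  by (intro poly_bounded_add poly_bounded_mult poly_bounded_Suc poly_bounded_const poly_bounded_id)

text \<open>The bound is affine in \<open>M\<close> with nonnegative coefficients \<open>a\<close>
  and \<open>b\<close>. This separates the number of enumerated sets from a polynomial in
  \<open>n\<close>.\<close>

lemma main_time_linear:
  assumes "1 \<le> M"
  shows "main_time n M \<le> M * main_time n 1"
proof -
  have *: "a + M * b \<le> M * (a + b)" for a b :: nat
    using assms by (simp add: algebra_simps)
  define a where "a = local_time n + (1 + (degs_time n + (limit_time n + (6 + n * (rank_time n + 6)))))"
  define b where "b = 7 * n + (load_time n + try_time n + 3)"
  have "main_time n m = a + m * b" for m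
    by (simp add: main_time_def gen_time_def enum_time_def a_def b_def algebra_simps)
  then show ?thesis using * [of a b] by simp
qed

context fcgp_input
begin

text \<open>Step bounds are natural numbers, hence the floor. It loses nothing as a bound on a
  cardinality; the exponent is the one obtained in \<open>card_small_le\<close>.\<close>

definition budget :: nat where
  "budget = nat \<lfloor>(1 / \<epsilon>) ^ (10 * k)\<rfloor>"

lemma budget_ge_1: "1 \<le> budget"
proof -
  have "1 \<le> (1 / \<epsilon>) ^ (10 * k)" using eps by (intro one_le_power) simp
  then show ?thesis by (simp add: budget_def le_nat_iff le_floor_iff)
qed

lemma budget_le: "real budget \<le> (1 / \<epsilon>) ^ (10 * k)"
proof -
  have "0 \<le> (1 / \<epsilon>) ^ (10 * k)" using eps by simp
  then show ?thesis by (simp add: budget_def)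
qed

lemma card_small_le:
  assumes e: "3 * \<epsilon> < 2" and L: "limit L" and R: "R \<subseteq> {..<n}" "card R \<le> k * L"
  shows "card (small R n) \<le> budget"
proof -
  \<comment> \<open>\<open>L = 0\<close> misses the threshold 9, so it must be the cap
    \<open>n\<close>; then \<open>n = 0\<close> and \<open>k = 0\<close>.\<close>
  have kL: "k = 0 \<or> 0 < L" using L k_le by (cases "L = 0") (auto simp: limit_def)
  have "small R n = {U. U \<subseteq> R \<and> card U \<le> k}" using R by (auto simp: small_def)
  then have "card (small R n) \<le> (3 * L) ^ k"
    using card_small_subsets [OF _ R(2) kL] R(1) finite_sub by simp
  then have "real (card (small R n)) \<le> real (3 * L) ^ k"
    by (metis of_nat_le_iff of_nat_power)
  also have "\<dots> \<le> ((1 / \<epsilon>) ^ 10) ^ k"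
  proof (cases "k = 0")
    case False
    then have "(real L - 1) * \<epsilon> < 9" using kL L by (simp add: limit_def)
    then have "real L * \<epsilon> \<le> 10" using eps by (simp add: algebra_simps)
    then have "real (3 * L) \<le> 30 * (1 / \<epsilon>)" using eps by (simp add: field_simps)
    \<comment> \<open>Since \<open>1 / \<epsilon>\<close> exceeds \<open>3 / 2\<close>, its ninth
      power absorbs the constant 30. This is where \<open>\<epsilon>\<close> must stay away from
      1.\<close>
    also have "\<dots> \<le> (1 / \<epsilon>) ^ 9 * (1 / \<epsilon>)"
    proof (rule mult_right_mono)
      have "(3 / 2) ^ 9 \<le> (1 / \<epsilon>) ^ 9" using e eps by (intro power_mono) (auto simp: field_simps)
      moreover have "30 \<le> (3 / 2 :: real) ^ 9" by (simp add: power_divide)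
      ultimately show "30 \<le> (1 / \<epsilon>) ^ 9" by linarith
    qed (use eps in simp)
    also have "\<dots> = (1 / \<epsilon>) ^ 10" using power_add [of "1 / \<epsilon>" 9 1] by simp
    finally show ?thesis by (intro power_mono) simp_all
  qed simp
  also have "\<dots> = (1 / \<epsilon>) ^ (10 * k)" by (simp add: power_mult)
  finally have "int (card (small R n)) \<le> \<lfloor>(1 / \<epsilon>) ^ (10 * k)\<rfloor>" by (simp add: le_floor_iff)
  then show ?thesis by (simp add: budget_def le_nat_iff)
qed

lemma runs_refine:
  assumes g: "good s" and e: "3 * \<epsilon> < 2"
    and T: "degs_time n + (limit_time n + (gen_time n budget + enum_time n budget)) \<le> T"
  shows "runs E (Seq degs_prog (Seq limit_prog (Seq gen_prog enum_prog))) s T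
    (\<lambda>s'. good s' \<and> (1 - \<epsilon>) * opt \<alpha> {..<n} E k \<le> f (output_set s'))"
    (is "runs E _ _ _ ?Q")
proof (rule runs_Seq [OF _ T])
  have p: "params s" using g by (simp add: good_def)
  show "runs E degs_prog s (degs_time n) (\<lambda>s'. runs E (Seq limit_prog (Seq gen_prog enum_prog)) s'
    (limit_time n + (gen_time n budget + enum_time n budget)) ?Q)"
  proof (rule runs_conseq [OF runs_degs_prog [OF p order_refl] order_refl])
    fix s1 assume fr1: "frame degs_prog s s1" and D: "\<forall>v<n. real (arrs s1 ''D'' v) = degs {v}"
    have g1: "good s1" by (rule good_frame [OF g fr1]) auto
    then have p1: "params s1" by (simp add: good_def)
    show "runs E (Seq limit_prog (Seq gen_prog enum_prog)) s1
      (limit_time n + (gen_time n budget + enum_time n budget)) ?Q"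
    proof (rule runs_Seq [OF _ order_refl], rule runs_conseq [OF runs_limit_prog [OF p1 order_refl] order_refl])
      fix s2 assume fr2: "frame limit_prog s1 s2" and "\<exists>L. nvars s2 ''N'' = k * L \<and> limit L"
      then obtain L where N: "nvars s2 ''N'' = k * L" and L: "limit L" by blast
      have g2: "good s2" by (rule good_frame [OF g1 fr2]) auto
      then have p2: "params s2" by (simp add: good_def)
      have D2: "real (arrs s2 ''D'' v) = degs {v}" if "v < n" for v
        using fr2 D that by (simp add: frame_def)
      define R where "R = top_set (arrs s2 ''D'') n (nvars s2 ''N'')"
      have R: "R \<subseteq> {..<n}" by (auto simp: R_def top_set_def)
      have cR: "card R = min n (k * L)" by (simp add: R_def card_top_set N)
      have M: "card (small R n) \<le> budget" using card_small_le [OF e L R] cR by simp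
      have "degs {y} \<le> degs {x}" if "x \<in> R" "y \<in> {..<n} - R" for x y
      proof -
        have xy: "x < n" "y < n" using that R by auto
        have "arrs s2 ''D'' y \<le> arrs s2 ''D'' x"
          using that by (intro top_set_degree [of x _ n "nvars s2 ''N''"]) (auto simp: R_def)
        then show ?thesis using D2 [OF xy(1)] D2 [OF xy(2)] by linarith
      qed
      moreover have "R = {..<n} \<or> k = 0 \<or> card R = k * L \<and> 9 \<le> L * \<epsilon>"
      proof (cases "n \<le> k * L")
        case True
        then show ?thesis by (simp add: R_def N top_set_all)
      next
        case False
        \<comment> \<open>For positive \<open>k\<close> the cap \<open>L = n\<close> would give
          \<open>n \<le> k * L\<close>. So the threshold has been reached and \<open>R\<close> has
          its full size.\<close>
        then have "k = 0 \<or> L \<noteq> n" by (cases k) auto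
        then show ?thesis using L cR False by (auto simp: limit_def)
      qed
      ultimately obtain U where U: "U \<subseteq> R" "card U = k" "(1 - \<epsilon>) * opt \<alpha> {..<n} E k \<le> f U"
        using top_approx [OF R, of k L \<epsilon>] k_le eps by auto
      show "runs E (Seq gen_prog enum_prog) s2 (gen_time n budget + enum_time n budget) ?Q"
      proof (rule runs_Seq [OF _ order_refl],
          rule runs_conseq [OF runs_gen_prog [OF p2 M [unfolded R_def] order_refl] order_refl])
        fix s3 assume fr3: "frame gen_prog s2 s3"
          and "\<exists>rep. stored s3 rep \<and> rep ` {..<nvars s3 ''cnt''} =
            small (top_set (arrs s2 ''D'') n (nvars s2 ''N'')) n"
        then obtain rep where rep: "stored s3 rep" "rep ` {..<nvars s3 ''cnt''} = small R n"
          unfolding R_def by blast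
        have g3: "good s3" by (rule good_frame [OF g2 fr3]) auto
        show "runs E enum_prog s3 (enum_time n budget) ?Q"
          by (rule runs_conseq [OF runs_enum_prog [OF g3 rep M order_refl R] order_refl])
             (use U in \<open>auto intro: order_trans\<close>)
      qed
    qed
  qed
qed

lemma runs_main_prog:
  "runs E main_prog (input_state n k \<alpha> \<epsilon>) (main_time n budget)
    (\<lambda>s'. good s' \<and> (1 - \<epsilon>) * opt \<alpha> {..<n} E k \<le> f (output_set s'))"
    (is "runs E _ _ _ ?Q")
  unfolding main_prog_def
proof (rule runs_Seq)
  let ?r = "Seq degs_prog (Seq limit_prog (Seq gen_prog enum_prog))"
  let ?T = "degs_time n + (limit_time n + (gen_time n budget + enum_time n budget))"
  let ?c = "RLess (RAdd (RVar ''eps'') (RAdd (RVar ''eps'') (RVar ''eps''))) (ROfNat (num 2))"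
  show "runs E local_prog (input_state n k \<alpha> \<epsilon>) (local_time n)
    (\<lambda>s'. runs E (Cond ?c ?r Skip) s' (1 + ?T) ?Q)"
  proof (rule runs_conseq [OF runs_local_prog order_refl])
    fix s assume s: "good s \<and> swap_opt (output_set s)"
    then have b: "bval E ?c s \<longleftrightarrow> 3 * \<epsilon> < 2" by (simp add: good_def params_def)
    show "runs E (Cond ?c ?r Skip) s (1 + ?T) ?Q"
    proof (rule runs_Cond [OF _ _ order_refl])
      assume "bval E ?c s"
      then show "runs E ?r s ?T ?Q" using runs_refine [OF conjunct1 [OF s] _ order_refl] b by simp
    next
      assume "\<not> bval E ?c s"
      \<comment> \<open>For \<open>\<epsilon> \<ge> 2 / 3\<close> the factor \<open>1 / 3\<close> of
        the local optimum is already good enough.\<close>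
      then have "1 - \<epsilon> \<le> 1 / 3" using b by simp
      moreover have o: "opt \<alpha> {..<n} E k \<le> 3 * f (output_set s)"
        using s by (intro local_approx) (auto simp: good_def)
      moreover have "0 \<le> opt \<alpha> {..<n} E k"
        using s cov_le_opt [of "output_set s" k] cov_nonneg [of "output_set s"] by (simp add: good_def)
      ultimately have "(1 - \<epsilon>) * opt \<alpha> {..<n} E k \<le> 1 / 3 * opt \<alpha> {..<n} E k"
        by (intro mult_right_mono)
      then have "(1 - \<epsilon>) * opt \<alpha> {..<n} E k \<le> f (output_set s)" using o by linarith
      then show "runs E Skip s ?T ?Q"
        using s by (intro runs_Skip) (simp_all add: enum_time_def)
    qed
  qed
qed (simp add: main_time_def)

end

theorem theorem4:
  fixes \<alpha> :: real
  assumes "1 / 3 \<le> \<alpha>" and "\<alpha> \<le> 1"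
  shows "\<exists>P. max_fcgp_approx_scheme \<alpha> P"
proof -
  obtain C b where poly: "\<And>n. main_time n 1 \<le> C * max 1 n ^ b"
    using poly_bounded_main_time unfolding poly_bounded_def by blast
  have "max_fcgp_approx_scheme \<alpha> main_prog"
    unfolding max_fcgp_approx_scheme_def
  \<comment> \<open>\<open>C\<close> and \<open>b\<close> bound the polynomial part at
    \<open>M = 1\<close>; the exponent 10 is that of \<open>budget\<close>, which accounts for the
    number of enumerated sets.\<close>
  proof (rule exI [of _ "real C"], rule exI [of _ 10], rule exI [of _ b], intro allI impI)
    fix n k :: nat and E :: "nat set set" and \<epsilon> :: real
    assume "simple_graph {..<n} E" "k \<le> n" "0 < \<epsilon>" "\<epsilon> < 1"
    then interpret fcgp_input n E \<alpha> k \<epsilon>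
      using assms by unfold_locales auto
    obtain t s where run: "exec E main_prog (input_state n k \<alpha> \<epsilon>) t s" "t \<le> main_time n budget"
      "good s" "(1 - \<epsilon>) * opt \<alpha> {..<n} E k \<le> f (output_set s)"
      using runs_main_prog unfolding runs_def by blast
    have "t \<le> budget * (C * max 1 n ^ b)"
      using run(2) main_time_linear [OF budget_ge_1] mult_le_mono2 [OF poly] le_trans by meson
    then have "real t \<le> real (budget * (C * max 1 n ^ b))" by (rule of_nat_mono)
    also have "\<dots> = real budget * (real C * real (max 1 n) ^ b)"
      by (simp only: of_nat_mult of_nat_power)
    also have "\<dots> \<le> (1 / \<epsilon>) ^ (10 * k) * (real C * real (max 1 n) ^ b)"
      by (rule mult_right_mono [OF budget_le]) simp
    also have "\<dots> = real C * (1 / \<epsilon>) ^ (10 * k) * real (max 1 n) ^ b"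
      by (simp only: mult_ac)
    finally show "\<exists>t s. exec E main_prog (input_state n k \<alpha> \<epsilon>) t s
           \<and> real t \<le> real C * (1 / \<epsilon>) ^ (10 * k) * real (max 1 n) ^ b
           \<and> output_set s \<subseteq> {..<n}
           \<and> card (output_set s) = k
           \<and> cov \<alpha> {..<n} E (output_set s) \<ge> (1 - \<epsilon>) * opt \<alpha> {..<n} E k"
      using run by (auto simp: good_def)
  qed
  then show ?thesis by blast
qed

end
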